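(* Let $(X,r)$ be a finite non-degenerate involutive set-theoretic solution of the Yang--Baxter equation, with structure group $G(X,r)$. Then the following statements are equivalent: (1) $(X,r)$ is a multipermutation solution. (2) $G(X,r)$ is left orderable. (3) $G(X,r)$ is poly-$\mathbb{Z}$.
   Context: A set-theoretic solution of the Yang--Baxter equation is a pair $(X,r)$, where $X$ is a set and $r\colon X\times X\to X\times X$ is a bijective map such that $$(r\times\mathrm{id}_X)(\mathrm{id}_X\times r)(r\times\mathrm{id}_X)=(\mathrm{id}_X\times r)(r\times\mathrm{id}_X)(\mathrm{id}_X\times r)$$ as maps $X^3\to X^3$. It is finite if $X$ is a finite set. Write $r(x,y)=(\sigma_x(y),\gamma_y(x))$. The solution is involutive if $r^2=\mathrm{id}_{X\times X}$, and non-degenerate if $\sigma_x$ and $\gamma_x$ are permutations of $X$ for all $x\in X$. The structure group $G(X,r)$ is the group presented with set of generators $X$ and with relations $xy=uv$ whenever $x,y,u,v\in X$ satisfy $r(x,y)=(u,v)$. Retraction: for a non-degenerate involutive solution $(X,r)$, consider the equivalence relation on $X$ given by $x\sim y$ if and only if $\sigma_x=\sigma_y$. Writing $[x]$ for the class of $x$, the retraction $\mathrm{Ret}(X,r)$ is the (non-degenerate involutive) solution induced by $r$ on the quotient set $X/{\sim}$, namely $([x],[y])\mapsto([\sigma_x(y)],[\gamma_y(x)])$ (it is known that this is well defined). Define recursively $\mathrm{Ret}^1(X,r)=\mathrm{Ret}(X,r)$ and $\mathrm{Ret}^{m+1}(X,r)=\mathrm{Ret}(\mathrm{Ret}^m(X,r))$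 for $m\ge 1$. The solution $(X,r)$ is a multipermutation solution of level $m$ if $m$ is the minimal positive integer such that $\mathrm{Ret}^m(X,r)$ has only one element; it is a multipermutation solution if it is one of level $m$ for some positive integer $m$. A group $G$ is left orderable if there is a total order $<$ on $G$ such that for any $x,y,z\in G$, $x<y$ implies $zx<zy$. A group $G$ is poly-$\mathbb{Z}$ if it has a subnormal series $\{1\}=G_0\triangleleft G_1\triangleleft\cdots\triangleleft G_n=G$ such that each quotient $G_i/G_{i-1}$ is isomorphic to $\mathbb{Z}$. *)

theory Defs
  imports "HOL-Algebra.Elementary_Groups"
begin

section \<open>Set-theoretic solutions of the Yang--Baxter equation\<close>

text \<open>
  A solution lives on a carrier set \<open>X\<close>; the values of \<open>r\<close> outside \<open>X \<times> X\<close> are irrelevant.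
\<close>

type_synonym 'a sol = "'a set \<times> ('a \<times> 'a \<Rightarrow> 'a \<times> 'a)"

definition r12 :: "('a \<times> 'a \<Rightarrow> 'a \<times> 'a) \<Rightarrow> 'a \<times> 'a \<times> 'a \<Rightarrow> 'a \<times> 'a \<times> 'a" where
  "r12 r = (\<lambda>(x, y, z). (fst (r (x, y)), snd (r (x, y)), z))"

definition r23 :: "('a \<times> 'a \<Rightarrow> 'a \<times> 'a) \<Rightarrow> 'a \<times> 'a \<times> 'a \<Rightarrow> 'a \<times> 'a \<times> 'a" where
  "r23 r = (\<lambda>(x, y, z). (x, fst (r (y, z)), snd (r (y, z))))"

definition ybe_solution :: "'a sol \<Rightarrow> bool" where
  "ybe_solution = (\<lambda>(X, r). bij_betw r (X \<times> X) (X \<times> X) \<and>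
     (\<forall>t \<in> X \<times> X \<times> X. r12 r (r23 r (r12 r t)) = r23 r (r12 r (r23 r t))))"

definition sigma :: "('a \<times> 'a \<Rightarrow> 'a \<times> 'a) \<Rightarrow> 'a \<Rightarrow> 'a \<Rightarrow> 'a" where
  "sigma r x y = fst (r (x, y))"

definition gamma :: "('a \<times> 'a \<Rightarrow> 'a \<times> 'a) \<Rightarrow> 'a \<Rightarrow> 'a \<Rightarrow> 'a" where
  "gamma r y x = snd (r (x, y))"

definition involutive :: "'a sol \<Rightarrow> bool" where
  "involutive = (\<lambda>(X, r). \<forall>p \<in> X \<times> X. r (r p) = p)"

definition non_degenerate :: "'a sol \<Rightarrow> bool" where
  "non_degenerate = (\<lambda>(X, r). \<forall>x \<in> X. bij_betw (sigma r x) X X \<and> bij_betw (gamma r x) X X)"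


section \<open>Retraction\<close>

definition ret_rel :: "'a sol \<Rightarrow> ('a \<times> 'a) set" where
  "ret_rel = (\<lambda>(X, r). {(x, y). x \<in> X \<and> y \<in> X \<and> (\<forall>z \<in> X. sigma r x z = sigma r y z)})"

text \<open>
  The induced solution on the quotient set: a pair of classes \<open>(A, B)\<close> is sent to the unique
  element of the set of all \<open>([\<sigma>\<^sub>x(y)], [\<gamma>\<^sub>y(x)])\<close> with \<open>x \<in> A\<close> and \<open>y \<in> B\<close>.
\<close>

definition quotient_sol :: "'a sol \<Rightarrow> 'a set sol" where
  "quotient_sol S = (let r = snd S; E = ret_rel S in
     (fst S // E,
      \<lambda>(A, B). the_elem ((\<lambda>(x, y). (E `` {sigma r x y}, E `` {gamma r y x})) ` (A \<times> B))))"

text \<open>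
  Passing to the quotient changes the type from \<open>'a\<close> to \<open>'a set\<close>, so \<^const>\<open>quotient_sol\<close> cannot be
  iterated as it stands.  To stay in one type, the quotient solution is carried back to \<open>'a\<close>
  along the injection choosing a representative of each class; the result is isomorphic, as a
  solution, to the quotient solution (lemma \<open>Ret_iso\<close>).
\<close>

definition transport :: "('a \<Rightarrow> 'b) \<Rightarrow> 'a sol \<Rightarrow> 'b sol" where
  "transport f = (\<lambda>(X, r).
     (f ` X, \<lambda>(a, b). map_prod f f (r (inv_into X f a, inv_into X f b))))"

definition Ret :: "'a sol \<Rightarrow> 'a sol" where
  "Ret S = transport (\<lambda>A. SOME x. x \<in> A) (quotient_sol S)"

definition sol_iso :: "('a \<Rightarrow> 'b) \<Rightarrow> 'a sol \<Rightarrow> 'b sol \<Rightarrow> bool" where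
  "sol_iso f = (\<lambda>(X, r) (Y, s). bij_betw f X Y \<and>
     (\<forall>x \<in> X. \<forall>y \<in> X. s (f x, f y) = map_prod f f (r (x, y))))"

lemma sol_iso_transport:
  assumes "inj_on f (fst S)"
  shows "sol_iso f S (transport f S)"
  using assms by (auto simp: sol_iso_def transport_def bij_betw_def split: prod.splits)

lemma equiv_ret_rel: "equiv (fst S) (ret_rel S)"
  by (cases S) (auto simp: equiv_def refl_on_def sym_def trans_def ret_rel_def)

lemma Ret_iso: "sol_iso (\<lambda>A. SOME x. x \<in> A) (quotient_sol S) (Ret S)"
proof -
  have "inj_on (\<lambda>A. SOME x. x \<in> A) (fst S // ret_rel S)"
  proof (rule inj_onI)
    fix A B assume A: "A \<in> fst S // ret_rel S" and B: "B \<in> fst S // ret_rel S"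
      and eq: "(SOME x. x \<in> A) = (SOME x. x \<in> B)"
    have "A \<noteq> {}" "B \<noteq> {}"
      using A B in_quotient_imp_non_empty[OF equiv_ret_rel] by blast+
    then have "(SOME x. x \<in> A) \<in> A" "(SOME x. x \<in> B) \<in> B"
      by (simp_all add: some_in_eq)
    then show "A = B"
      using quotient_disj[OF equiv_ret_rel A B] eq by auto
  qed
  then show ?thesis
    unfolding Ret_def by (intro sol_iso_transport) (simp add: quotient_sol_def Let_def)
qed

definition multipermutation_level :: "nat \<Rightarrow> 'a sol \<Rightarrow> bool" where
  "multipermutation_level m S \<longleftrightarrow>
     0 < m \<and> card (fst ((Ret ^^ m) S)) = 1 \<and>
     (\<forall>k. 0 < k \<and> k < m \<longrightarrow> card (fst ((Ret ^^ k) S)) \<noteq> 1)"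

definition multipermutation :: "'a sol \<Rightarrow> bool" where
  "multipermutation S \<longleftrightarrow> (\<exists>m. multipermutation_level m S)"


section \<open>Groups given by generators and relations\<close>

text \<open>
  The letters \<open>(x, True)\<close> and \<open>(x, False)\<close> stand for the generator \<open>x\<close> and its formal inverse.
  A pair \<open>(p, q)\<close> of words in \<open>R\<close> stands for the relation \<open>p = q\<close>.
\<close>

definition group_words :: "'a set \<Rightarrow> ('a \<times> bool) list set" where
  "group_words X = lists (X \<times> UNIV)"

inductive_set pres_cong ::
    "'a set \<Rightarrow> (('a \<times> bool) list \<times> ('a \<times> bool) list) set
      \<Rightarrow> (('a \<times> bool) list \<times> ('a \<times> bool) list) set"
  for X R where
  refl: "w \<in> group_words X \<Longrightarrow> (w, w) \<in> pres_cong X R"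
| sym: "(v, w) \<in> pres_cong X R \<Longrightarrow> (w, v) \<in> pres_cong X R"
| trans: "(u, v) \<in> pres_cong X R \<Longrightarrow> (v, w) \<in> pres_cong X R \<Longrightarrow> (u, w) \<in> pres_cong X R"
| cancel: "x \<in> X \<Longrightarrow> u \<in> group_words X \<Longrightarrow> v \<in> group_words X \<Longrightarrow>
     (u @ [(x, b), (x, \<not> b)] @ v, u @ v) \<in> pres_cong X R"
| rel: "(p, q) \<in> R \<Longrightarrow> p \<in> group_words X \<Longrightarrow> q \<in> group_words X \<Longrightarrow>
     u \<in> group_words X \<Longrightarrow> v \<in> group_words X \<Longrightarrow> (u @ p @ v, u @ q @ v) \<in> pres_cong X R"

definition presented_group ::
    "'a set \<Rightarrow> (('a \<times> bool) list \<times> ('a \<times> bool) list) set \<Rightarrow> ('a \<times> bool) list set monoid" where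
  "presented_group X R =
     \<lparr>carrier = group_words X // pres_cong X R,
      monoid.mult = (\<lambda>A B. \<Union>a\<in>A. \<Union>b\<in>B. pres_cong X R `` {a @ b}),
      one = pres_cong X R `` {[]}\<rparr>"

lemma group_words_append [simp]:
  "u @ v \<in> group_words X \<longleftrightarrow> u \<in> group_words X \<and> v \<in> group_words X"
  by (simp add: group_words_def)

lemma group_words_Nil [simp]: "[] \<in> group_words X"
  by (simp add: group_words_def)

lemma group_words_Cons [simp]: "a # v \<in> group_words X \<longleftrightarrow> fst a \<in> X \<and> v \<in> group_words X"
  by (cases a) (simp add: group_words_def)

lemma group_words_inverse [simp]: "rev (map (apsnd Not) w) \<in> group_words X \<longleftrightarrow> w \<in> group_words X"
  by (induction w) auto

lemma pres_cong_words:
  "(v, w) \<in> pres_cong X R \<Longrightarrow> v \<in> group_words X \<and> w \<in> group_words X"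
  by (induction rule: pres_cong.induct) auto

lemma equiv_pres_cong: "equiv (group_words X) (pres_cong X R)"
  unfolding equiv_def refl_on_def sym_def trans_def
  by (auto dest: pres_cong_words intro: pres_cong.refl pres_cong.sym pres_cong.trans)

lemma pres_cong_context:
  assumes "(v, w) \<in> pres_cong X R" "a \<in> group_words X" "b \<in> group_words X"
  shows "(a @ v @ b, a @ w @ b) \<in> pres_cong X R"
  using assms
proof (induction rule: pres_cong.induct)
  case (cancel x u v c)
  then show ?case using pres_cong.cancel[of x X "a @ u" "v @ b" c R] by simp
next
  case (rel p q u v)
  then show ?case using pres_cong.rel[of p q R X "a @ u" "v @ b"] by simp
qed (auto intro: pres_cong.refl pres_cong.sym pres_cong.trans)

lemma pres_cong_append:
  assumes "(u, u') \<in> pres_cong X R" "(v, v') \<in> pres_cong X R"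
  shows "(u @ v, u' @ v') \<in> pres_cong X R"
  using pres_cong_context[OF assms(1), of "[]" v] pres_cong_context[OF assms(2), of u' "[]"]
    assms[THEN pres_cong_words] by (auto intro: pres_cong.trans)

lemma presented_group_mult:
  assumes "u \<in> group_words X" "v \<in> group_words X"
  shows "pres_cong X R `` {u} \<otimes>\<^bsub>presented_group X R\<^esub> pres_cong X R `` {v} = pres_cong X R `` {u @ v}"
proof -
  have "pres_cong X R `` {a @ b} = pres_cong X R `` {u @ v}"
    if "(u, a) \<in> pres_cong X R" "(v, b) \<in> pres_cong X R" for a b
    using equiv_class_eq[OF equiv_pres_cong pres_cong_append[OF that]] by simp
  then have "(\<Union>a \<in> pres_cong X R `` {u}. \<Union>b \<in> pres_cong X R `` {v}. pres_cong X R `` {a @ b}) =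
      (\<Union>a \<in> pres_cong X R `` {u}. \<Union>b \<in> pres_cong X R `` {v}. pres_cong X R `` {u @ v})"
    by (intro SUP_cong HOL.refl) (simp_all only: Image_singleton_iff)
  also have "\<dots> = pres_cong X R `` {u @ v}"
  proof -
    have "u \<in> pres_cong X R `` {u}" "v \<in> pres_cong X R `` {v}"
      using assms by (simp_all add: pres_cong.refl)
    then show ?thesis by (metis UN_constant empty_iff)
  qed
  finally show ?thesis by (simp add: presented_group_def)
qed

lemma pres_cong_inverse:
  assumes "w \<in> group_words X"
  shows "(rev (map (apsnd Not) w) @ w, []) \<in> pres_cong X R"
  using assms
proof (induction w)
  case (Cons a w)
  obtain x b where a: "a = (x, b)" by fastforce
  have "rev (map (apsnd Not) w) \<in> group_words X"
    using Cons.prems by simp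
  then have "(rev (map (apsnd Not) w) @ [(x, \<not> b), (x, \<not> \<not> b)] @ w,
      rev (map (apsnd Not) w) @ w) \<in> pres_cong X R"
    using Cons.prems a by (intro pres_cong.cancel) auto
  then show ?case using Cons a by (auto intro: pres_cong.trans)
qed (simp add: pres_cong.refl)

lemma group_presented_group: "group (presented_group X R)"
proof (rule groupI)
  let ?G = "presented_group X R" and ?c = "\<lambda>w. pres_cong X R `` {w}"
  have carr: "A \<in> carrier ?G \<longleftrightarrow> (\<exists>w \<in> group_words X. A = ?c w)" for A
    by (auto simp: presented_group_def quotient_def)
  have one: "\<one>\<^bsub>?G\<^esub> = ?c []" by (simp add: presented_group_def)
  show "A \<otimes>\<^bsub>?G\<^esub> B \<in> carrier ?G" if "A \<in> carrier ?G" "B \<in> carrier ?G" for A B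
    using that by (fastforce simp: carr presented_group_mult)
  show "\<one>\<^bsub>?G\<^esub> \<in> carrier ?G" using one by (auto simp: carr)
  show "(A \<otimes>\<^bsub>?G\<^esub> B) \<otimes>\<^bsub>?G\<^esub> C = A \<otimes>\<^bsub>?G\<^esub> (B \<otimes>\<^bsub>?G\<^esub> C)"
    if "A \<in> carrier ?G" "B \<in> carrier ?G" "C \<in> carrier ?G" for A B C
    using that by (auto simp: carr presented_group_mult)
  show "\<one>\<^bsub>?G\<^esub> \<otimes>\<^bsub>?G\<^esub> A = A" if "A \<in> carrier ?G" for A
    using that by (auto simp: carr one presented_group_mult)
  show "\<exists>B \<in> carrier ?G. B \<otimes>\<^bsub>?G\<^esub> A = \<one>\<^bsub>?G\<^esub>" if A: "A \<in> carrier ?G" for A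
  proof -
    obtain w where w: "w \<in> group_words X" "A = ?c w" using A by (auto simp: carr)
    let ?v = "rev (map (apsnd Not) w)"
    have v: "?v \<in> group_words X" using w(1) by simp
    have "?c ?v \<otimes>\<^bsub>?G\<^esub> A = \<one>\<^bsub>?G\<^esub>"
      using w v equiv_class_eq[OF equiv_pres_cong pres_cong_inverse[OF w(1)]]
      by (simp add: presented_group_mult one)
    then show ?thesis using v carr by blast
  qed
qed

text \<open>Universal property: a map respecting the relations extends to a homomorphism.\<close>

definition word_eval :: "('b, 'c) monoid_scheme \<Rightarrow> ('a \<Rightarrow> 'b) \<Rightarrow> ('a \<times> bool) list \<Rightarrow> 'b" where
  "word_eval H f w =
     foldr (\<lambda>(x, b) h. (if b then f x else inv\<^bsub>H\<^esub> (f x)) \<otimes>\<^bsub>H\<^esub> h) w \<one>\<^bsub>H\<^esub>"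

lemma word_eval_closed:
  assumes "group H" "f \<in> X \<rightarrow> carrier H" "w \<in> group_words X"
  shows "word_eval H f w \<in> carrier H"
proof -
  interpret group H by fact
  have "f x \<in> carrier H" if "x \<in> X" for x using assms(2) that by auto
  then show ?thesis using assms(3) by (induction w) (auto simp: word_eval_def)
qed

lemma word_eval_append:
  assumes "group H" "f \<in> X \<rightarrow> carrier H" "v \<in> group_words X" "w \<in> group_words X"
  shows "word_eval H f (v @ w) = word_eval H f v \<otimes>\<^bsub>H\<^esub> word_eval H f w"
proof -
  interpret group H by fact
  note c = word_eval_closed[OF assms(1,2)]
  show ?thesis using assms(2,3)
  proof (induction v)
    case Nil
    then show ?case using c[OF assms(4)] by (simp add: word_eval_def)
  next
    case (Cons a v)
    obtain x b where a: "a = (x, b)" by fastforce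
    have "word_eval H f (a # u) = (if b then f x else inv\<^bsub>H\<^esub> (f x)) \<otimes>\<^bsub>H\<^esub> word_eval H f u" for u
      by (simp add: word_eval_def a)
    moreover have "f x \<in> carrier H" using Cons.prems a by auto
    ultimately show ?case using Cons c[OF assms(4)] c[of v] by (auto simp: m_assoc)
  qed
qed

lemma word_eval_cong:
  assumes "group H" "f \<in> X \<rightarrow> carrier H"
    and "\<And>p q. (p, q) \<in> R \<Longrightarrow> word_eval H f p = word_eval H f q"
    and "(v, w) \<in> pres_cong X R"
  shows "word_eval H f v = word_eval H f w"
  using assms(4)
proof (induction rule: pres_cong.induct)
  case (cancel x u v b)
  interpret group H by fact
  have "f x \<in> carrier H" using cancel assms(2) by auto
  then have "word_eval H f [(x, b), (x, \<not> b)] = \<one>\<^bsub>H\<^esub>"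
    by (simp add: word_eval_def)
  then show ?case
    using cancel word_eval_closed[OF assms(1,2)]
    by (simp add: word_eval_append[OF assms(1,2)] del: append_Cons append_Nil)
next
  case (rel p q u v)
  then show ?case using assms(3)[of p q] by (simp add: word_eval_append[OF assms(1,2)])
qed auto

lemma presented_group_universal:
  assumes "group H" "f \<in> X \<rightarrow> carrier H"
    and "\<And>p q. (p, q) \<in> R \<Longrightarrow> word_eval H f p = word_eval H f q"
  shows "\<exists>h \<in> hom (presented_group X R) H. \<forall>x \<in> X. h (pres_cong X R `` {[(x, True)]}) = f x"
proof -
  interpret group H by fact
  define h where "h A = word_eval H f (SOME w. w \<in> A)" for A
  have h: "h (pres_cong X R `` {w}) = word_eval H f w" if "w \<in> group_words X" for w
  proof -
    have "w \<in> pres_cong X R `` {w}" using that by (auto intro: pres_cong.refl)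
    then have "(SOME v. v \<in> pres_cong X R `` {w}) \<in> pres_cong X R `` {w}" by (rule someI)
    then show ?thesis unfolding h_def using word_eval_cong[OF assms] by fastforce
  qed
  have "h \<in> hom (presented_group X R) H"
  proof (rule homI)
    fix A assume "A \<in> carrier (presented_group X R)"
    then obtain v where "v \<in> group_words X" "A = pres_cong X R `` {v}"
      by (auto simp: presented_group_def quotient_def)
    then show "h A \<in> carrier H" using h word_eval_closed[OF assms(1,2)] by simp
  next
    fix A B assume "A \<in> carrier (presented_group X R)" "B \<in> carrier (presented_group X R)"
    then obtain v w where "v \<in> group_words X" "A = pres_cong X R `` {v}"
      "w \<in> group_words X" "B = pres_cong X R `` {w}"
      by (auto simp: presented_group_def quotient_def)
    then show "h (A \<otimes>\<^bsub>presented_group X R\<^esub> B) = h A \<otimes>\<^bsub>H\<^esub> h B"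
      by (simp add: presented_group_mult h word_eval_append[OF assms(1,2)])
  qed
  moreover have "h (pres_cong X R `` {[(x, True)]}) = f x" if "x \<in> X" for x
  proof -
    have "f x \<in> carrier H" using assms(2) that by auto
    then show ?thesis using h[of "[(x, True)]"] that by (simp add: word_eval_def)
  qed
  ultimately show ?thesis by blast
qed

definition structure_group :: "'a sol \<Rightarrow> ('a \<times> bool) list set monoid" where
  "structure_group = (\<lambda>(X, r). presented_group X
     {([(x, True), (y, True)], [(u, True), (v, True)]) | x y u v.
        x \<in> X \<and> y \<in> X \<and> u \<in> X \<and> v \<in> X \<and> r (x, y) = (u, v)})"


section \<open>Left orderable and poly-\<open>\<int>\<close> groups\<close>

definition left_orderable :: "('a, 'b) monoid_scheme \<Rightarrow> bool" where
  "left_orderable G \<longleftrightarrow> (\<exists>L. L \<subseteq> carrier G \<times> carrier G \<and> strict_linear_order_on (carrier G) L \<and>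
     (\<forall>x \<in> carrier G. \<forall>y \<in> carrier G. \<forall>z \<in> carrier G.
        (x, y) \<in> L \<longrightarrow> (z \<otimes>\<^bsub>G\<^esub> x, z \<otimes>\<^bsub>G\<^esub> y) \<in> L))"

definition poly_Z :: "('a, 'b) monoid_scheme \<Rightarrow> bool" where
  "poly_Z G \<longleftrightarrow> (\<exists>(n::nat) H. H 0 = {\<one>\<^bsub>G\<^esub>} \<and> H n = carrier G \<and>
     (\<forall>i \<le> n. subgroup (H i) G) \<and>
     (\<forall>i < n. H i \<lhd> G\<lparr>carrier := H (Suc i)\<rparr> \<and>
        G\<lparr>carrier := H (Suc i)\<rparr> Mod H i \<cong> integer_group))"

end

theory Submission
  imports Defs "HOL-Combinatorics.Permutations"
begin

text \<open>
  The structure group \<open>G\<close> carries a bijective cocycle onto \<open>\<int>\<^sup>X\<close>, on which \<open>G\<close> acts through a finite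
  permutation group; the kernel of this action, the socle, is abelian.  For a \<open>G\<close>-invariant
  equivalence relation \<open>E\<close> on \<open>X\<close> let \<open>K(E)\<close> be the set of elements whose cocycle has zero sum over
  every class of \<open>E\<close>.

  Let \<open>E\<^sub>n\<close> be the kernel of \<open>X \<rightarrow> Ret\<^sup>n(X)\<close>.  Then \<open>K(E\<^sub>n\<^sub>+\<^sub>1)\<close> acts trivially on \<open>X/E\<^sub>n\<close>, so the sums
  over the classes of \<open>E\<^sub>n\<close> embed \<open>K(E\<^sub>n\<^sub>+\<^sub>1)/K(E\<^sub>n)\<close> into a free abelian group.  If some \<open>E\<^sub>n\<close> is
  \<open>X \<times> X\<close>, this makes \<open>G\<close> poly-\<open>\<int>\<close>, hence left orderable.

  Conversely let \<open>G\<close> be left ordered.  Starting from \<open>E = X \<times> X\<close>, replace \<open>E\<close> by the orbit relation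
  of \<open>K(E)\<close> until it is stable.  If the stable \<open>E\<close> were not the equality, the socle would contain an
  element \<open>a\<close> of \<open>K(E)\<close> whose powers are cofinal in \<open>K(E)\<close>.  Its conjugates are then cofinal too and
  their products are positive; but the product of the conjugates of \<open>a\<close> over the permutations
  induced by \<open>K(E)\<close> is trivial, because averaging over the classes of \<open>E\<close> kills zero sum vectors.
  So \<open>E\<close> shrinks to the equality.  Since \<open>x E y\<close> implies that \<open>\<sigma>\<^sub>x(z)\<close> and \<open>\<sigma>\<^sub>y(z)\<close> lie in one
  orbit of \<open>K(E)\<close>, each step of this process costs one retraction, and some \<open>E\<^sub>n\<close> is \<open>X \<times> X\<close>.
\<close>

section \<open>Left orders and cofinal elements\<close>

lemma (in group) inv_mult_cancel [simp]:
  assumes "x \<in> carrier G" "y \<in> carrier G"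
  shows "inv x \<otimes> (x \<otimes> y) = y" "x \<otimes> (inv x \<otimes> y) = y"
  using assms by (simp_all flip: m_assoc)

locale left_ordered_group = group G for G (structure) +
  fixes L :: "('a \<times> 'a) set"
  assumes order: "strict_linear_order_on (carrier G) L"
    and left_mono: "\<lbrakk>x \<in> carrier G; y \<in> carrier G; z \<in> carrier G; (x, y) \<in> L\<rbrakk>
      \<Longrightarrow> (z \<otimes> x, z \<otimes> y) \<in> L"
begin

lemma less_trans: "(x, y) \<in> L \<Longrightarrow> (y, z) \<in> L \<Longrightarrow> (x, z) \<in> L"
  using order by (auto simp: strict_linear_order_on_def elim: transE)

lemma less_irrefl: "(x, x) \<notin> L"
  using order by (auto simp: strict_linear_order_on_def irrefl_def)

lemma less_linear:
  "x \<in> carrier G \<Longrightarrow> y \<in> carrier G \<Longrightarrow> (x, y) \<in> L \<or> x = y \<or> (y, x) \<in> L"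
  using order by (auto simp: strict_linear_order_on_def total_on_def)

lemma left_cancel:
  assumes "x \<in> carrier G" "y \<in> carrier G" "z \<in> carrier G" "(z \<otimes> x, z \<otimes> y) \<in> L"
  shows "(x, y) \<in> L"
proof -
  have "(inv z \<otimes> (z \<otimes> x), inv z \<otimes> (z \<otimes> y)) \<in> L"
    using assms by (intro left_mono[OF _ _ _ assms(4)]) auto
  then show ?thesis using assms by simp
qed

lemma mult_pos:
  assumes "x \<in> carrier G" "y \<in> carrier G" "(\<one>, y) \<in> L"
  shows "(x, x \<otimes> y) \<in> L"
  using left_mono[of \<one> y x] assms by simp

lemma mult_neg:
  assumes "x \<in> carrier G" "y \<in> carrier G" "(y, \<one>) \<in> L"
  shows "(x \<otimes> y, x) \<in> L"
  using left_mono[of y \<one> x] assms by simp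

lemma pow_pos:
  assumes "x \<in> carrier G" "(\<one>, x) \<in> L"
  shows "(\<one>, x [^] Suc n) \<in> L"
proof (induction n)
  case (Suc n)
  show ?case using Suc mult_pos[of "x [^] Suc n" x] assms less_trans by fastforce
qed (use assms in simp)

lemma pow_neg:
  assumes "x \<in> carrier G" "(x, \<one>) \<in> L"
  shows "(x [^] Suc n, \<one>) \<in> L"
proof (induction n)
  case (Suc n)
  show ?case using Suc mult_neg[of "x [^] Suc n" x] assms less_trans by fastforce
qed (use assms in simp)

lemma le_pow:
  assumes "x \<in> carrier G" "(\<one>, x) \<in> L"
  shows "x = x [^] Suc n \<or> (x, x [^] Suc n) \<in> L"
proof (cases n)
  case (Suc m)
  have "(x, x \<otimes> x [^] Suc m) \<in> L"
    using assms pow_pos by (intro mult_pos) auto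
  then show ?thesis using assms Suc by (metis nat_pow_Suc2)
qed (use assms in simp)

lemma finite_has_max:
  assumes "finite B" "B \<noteq> {}" "B \<subseteq> carrier G"
  shows "\<exists>a\<in>B. \<forall>b\<in>B. b = a \<or> (b, a) \<in> L"
  using assms
proof (induction B rule: finite_ne_induct)
  case (insert x B)
  then obtain a where a: "a \<in> B" "\<forall>b\<in>B. b = a \<or> (b, a) \<in> L" by auto
  with insert.prems have "(x, a) \<in> L \<or> x = a \<or> (a, x) \<in> L" by (intro less_linear) auto
  then show ?case
  proof (elim disjE)
    assume "(a, x) \<in> L"
    then show ?thesis using a less_trans by (intro bexI[of _ x]) auto
  qed (use a in auto)
qed simp

definition cofinal :: "'a set \<Rightarrow> 'a \<Rightarrow> bool" where
  "cofinal H a \<longleftrightarrow> a \<in> carrier G \<and> (\<forall>h\<in>H. \<exists>n::nat. (h, a [^] n) \<in> L)"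

text \<open>Powers of an element that is not positive never exceed \<open>\<one>\<close>.\<close>

lemma cofinal_pos:
  assumes "cofinal H a" "\<one> \<in> H"
  shows "(\<one>, a) \<in> L"
proof (rule ccontr)
  assume nl: "(\<one>, a) \<notin> L"
  have a: "a \<in> carrier G" using assms by (simp add: cofinal_def)
  obtain n :: nat where n: "(\<one>, a [^] n) \<in> L" using assms by (auto simp: cofinal_def)
  show False
  proof (cases n)
    case 0
    then show False using n less_irrefl by auto
  next
    case (Suc m)
    consider "a = \<one>" | "(a, \<one>) \<in> L" using less_linear[of a \<one>] a nl by auto
    then show False
    proof cases
      case 1
      then show False using n less_irrefl by simp
    next
      case 2
      then have "(a [^] n, \<one>) \<in> L" using pow_neg[of a m] a Suc by simp
      then show False using n less_irrefl less_trans by blast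
    qed
  qed
qed

text \<open>Commutation gives (ab)^n = a^n b^n, and right multiplication by the positive element
  b^n, n > 0, only enlarges a^n.\<close>

lemma cofinal_mult:
  assumes "cofinal H a" "cofinal H b" "\<one> \<in> H" "a \<otimes> b = b \<otimes> a"
  shows "cofinal H (a \<otimes> b)"
  unfolding cofinal_def
proof (intro conjI ballI)
  have ab: "a \<in> carrier G" "b \<in> carrier G" using assms by (auto simp: cofinal_def)
  then show "a \<otimes> b \<in> carrier G" by simp
  fix h assume "h \<in> H"
  then obtain n :: nat where n: "(h, a [^] n) \<in> L" using assms by (auto simp: cofinal_def)
  have "(a \<otimes> b) [^] n = a [^] n \<otimes> b [^] n"
    using assms(4) ab by (rule pow_mult_distrib)
  moreover have "a [^] n = a [^] n \<otimes> b [^] n \<or> (a [^] n, a [^] n \<otimes> b [^] n) \<in> L"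
  proof (cases n)
    case (Suc m)
    then show ?thesis using mult_pos[of "a [^] n" "b [^] n"] pow_pos[of b m] cofinal_pos[of H b] ab assms
      by auto
  qed simp
  ultimately show "\<exists>n::nat. (h, (a \<otimes> b) [^] n) \<in> L"
    using n less_trans by metis
qed

lemma conj_pow:
  assumes "g \<in> carrier G" "a \<in> carrier G"
  shows "(g \<otimes> a \<otimes> inv g) [^] (n::nat) = g \<otimes> a [^] n \<otimes> inv g"
proof (induction n)
  case (Suc n)
  show ?case using assms Suc by (simp add: m_assoc)
qed (use assms in simp)

text \<open>A left order need not be preserved by conjugation, so the bound is shifted by a power of
  \<open>a\<close>. With b = g a g^-1 and g < a^m, some n gives a^m h < g a^n = b^n g < b^n a^m =
  a^m b^n; cancelling a^m on the left leaves h < b^n.\<close>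

lemma cofinal_conj:
  assumes H: "subgroup H G" and a: "cofinal H a" "a \<in> H" and g: "g \<in> H"
    and comm: "(g \<otimes> a \<otimes> inv g) \<otimes> a = a \<otimes> (g \<otimes> a \<otimes> inv g)"
  shows "cofinal H (g \<otimes> a \<otimes> inv g)"
  unfolding cofinal_def
proof (intro conjI ballI)
  let ?b = "g \<otimes> a \<otimes> inv g"
  have gc: "g \<in> carrier G" "a \<in> carrier G" using H a g subgroup.mem_carrier by fast+
  then show b: "?b \<in> carrier G" by simp
  fix h assume h: "h \<in> H"
  then have hc: "h \<in> carrier G" using H subgroup.mem_carrier by fast
  obtain m :: nat where m: "(g, a [^] m) \<in> L" using a g by (auto simp: cofinal_def)
  have am: "a [^] k \<in> H" for k :: nat
    using H a(2) by (induction k) (auto simp: subgroup.one_closed subgroup.m_closed)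
  \<comment> \<open>Chosen so that left multiplication by \<open>g\<close> turns it into a^m
    h.\<close>
  have "inv g \<otimes> (a [^] m \<otimes> h) \<in> H"
    using H am h g by (simp add: subgroup.m_closed subgroup.m_inv_closed)
  then obtain n :: nat where n: "(inv g \<otimes> (a [^] m \<otimes> h), a [^] n) \<in> L"
    using a by (auto simp: cofinal_def)
  have "(g \<otimes> (inv g \<otimes> (a [^] m \<otimes> h)), g \<otimes> a [^] n) \<in> L"
    using n gc hc by (intro left_mono) auto
  moreover have "g \<otimes> (inv g \<otimes> (a [^] m \<otimes> h)) = a [^] m \<otimes> h"
    using gc hc by simp
  moreover have "g \<otimes> a [^] n = ?b [^] n \<otimes> g"
    using gc by (simp add: conj_pow) (simp add: m_assoc)
  moreover have "(?b [^] n \<otimes> g, ?b [^] n \<otimes> a [^] m) \<in> L"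
    using m gc b by (intro left_mono) auto
  moreover have "?b [^] n \<otimes> a [^] m = a [^] m \<otimes> ?b [^] n"
    using group_commutes_pow[OF group_commutes_pow[OF comm b gc(2), symmetric]] b gc by simp
  ultimately have "(a [^] m \<otimes> h, a [^] m \<otimes> ?b [^] n) \<in> L"
    using less_trans by metis
  then show "\<exists>n::nat. (h, ?b [^] n) \<in> L"
    using left_cancel gc hc b by blast
qed

text \<open>
  The conjugates of a cofinal element are cofinal, hence so are products of commuting conjugates.
\<close>

lemma conj_product_ne_one:
  assumes H: "subgroup H G" and a: "cofinal H a" "a \<in> D" "a \<in> H" and D: "subgroup D G"
    and comm: "\<And>b c. b \<in> D \<Longrightarrow> c \<in> D \<Longrightarrow> b \<otimes> c = c \<otimes> b"
    and conj: "\<And>g. g \<in> H \<Longrightarrow> g \<otimes> a \<otimes> inv g \<in> D"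
    and gs: "set gs \<subseteq> H" "gs \<noteq> []"
  shows "foldr (\<lambda>g p. g \<otimes> a \<otimes> inv g \<otimes> p) gs \<one> \<noteq> \<one>"
proof -
  have one: "\<one> \<in> H" using H by (rule subgroup.one_closed)
  have "foldr (\<lambda>g p. g \<otimes> a \<otimes> inv g \<otimes> p) gs \<one> \<in> D \<and>
      cofinal H (foldr (\<lambda>g p. g \<otimes> a \<otimes> inv g \<otimes> p) gs \<one>)"
    using gs(2,1)
  proof (induction gs rule: list_nonempty_induct)
    case (single g)
    then have "g \<otimes> a \<otimes> inv g \<in> D" "cofinal H (g \<otimes> a \<otimes> inv g)"
      using conj comm a by (auto intro!: cofinal_conj H)
    then show ?case by (simp add: cofinal_def)
  next
    case (cons g gs)
    then have "g \<otimes> a \<otimes> inv g \<in> D" "cofinal H (g \<otimes> a \<otimes> inv g)"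
      using conj comm a by (auto intro!: cofinal_conj H)
    then show ?case using cons one comm D
      by (auto intro!: cofinal_mult subgroup.m_closed)
  qed
  then show ?thesis using cofinal_pos[of H] one less_irrefl by metis
qed

end

section \<open>Positive cones, and left orders on poly-\<open>\<int>\<close> groups\<close>

text \<open>\<open>P\<close> serves as the positive cone: x < y means that x^-1 y lies in
  \<open>P\<close>, and x^-1 y is unchanged when x and y are multiplied by the same element on the
  left.\<close>

lemma (in group) cone_imp_left_orderable:
  assumes P: "P \<subseteq> carrier G" "\<one> \<notin> P" "\<And>x y. x \<in> P \<Longrightarrow> y \<in> P \<Longrightarrow> x \<otimes> y \<in> P"
    and tot: "\<And>x. x \<in> carrier G \<Longrightarrow> x \<noteq> \<one> \<Longrightarrow> x \<in> P \<or> inv x \<in> P"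
  shows "left_orderable G"
proof -
  define L where "L = {(x, y). x \<in> carrier G \<and> y \<in> carrier G \<and> inv x \<otimes> y \<in> P}"
  have "trans L"
  proof (rule transI)
    fix x y z assume "(x, y) \<in> L" "(y, z) \<in> L"
    then have *: "x \<in> carrier G" "y \<in> carrier G" "z \<in> carrier G" "inv x \<otimes> y \<in> P" "inv y \<otimes> z \<in> P"
      by (auto simp: L_def)
    then have "(inv x \<otimes> y) \<otimes> (inv y \<otimes> z) \<in> P" using P(3) by blast
    moreover have "(inv x \<otimes> y) \<otimes> (inv y \<otimes> z) = inv x \<otimes> (y \<otimes> inv y) \<otimes> z"
      using * by (simp add: m_assoc)
    ultimately show "(x, z) \<in> L" using * by (simp add: L_def)
  qed
  moreover have "irrefl L" using P(2) by (auto simp: irrefl_def L_def)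
  moreover have "total_on (carrier G) L"
  proof (rule total_onI)
    fix x y assume *: "x \<in> carrier G" "y \<in> carrier G" "x \<noteq> y"
    then have "inv x \<otimes> y \<noteq> \<one>" by (metis inv_closed inv_equality inv_inv)
    moreover have "inv (inv x \<otimes> y) = inv y \<otimes> x" using * by (simp add: inv_mult_group)
    ultimately show "(x, y) \<in> L \<or> (y, x) \<in> L"
      using tot[of "inv x \<otimes> y"] * by (auto simp: L_def)
  qed
  moreover have "(z \<otimes> x, z \<otimes> y) \<in> L"
    if "x \<in> carrier G" "y \<in> carrier G" "z \<in> carrier G" "(x, y) \<in> L" for x y z
  proof -
    have "inv (z \<otimes> x) \<otimes> (z \<otimes> y) = inv x \<otimes> (inv z \<otimes> z) \<otimes> y"
      using that by (simp add: inv_mult_group m_assoc del: l_inv)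
    then show ?thesis using that by (simp add: L_def)
  qed
  ultimately show ?thesis
    unfolding left_orderable_def strict_linear_order_on_def
    by (intro exI[of _ L]) (auto simp: L_def)
qed

text \<open>Composing the isomorphism with the projection trades the quotient group for an
  integer-valued homomorphism on \<open>G\<close> itself.\<close>

lemma (in group) Mod_iso_integer_hom:
  assumes "N \<lhd> G" "G Mod N \<cong> integer_group"
  shows "\<exists>\<phi> \<in> hom G integer_group. \<forall>x\<in>carrier G. \<phi> x = 0 \<longleftrightarrow> x \<in> N"
proof -
  interpret N: normal N G by fact
  interpret Q: group "G Mod N" by (rule N.factorgroup_is_group)
  obtain h where h: "h \<in> iso (G Mod N) integer_group" using assms(2) by (auto simp: is_iso_def)
  have hh: "h \<in> hom (G Mod N) integer_group" using h by (simp add: iso_def)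
  have inj: "inj_on h (carrier (G Mod N))" using h by (auto simp: iso_def bij_betw_def)
  have h1: "h \<one>\<^bsub>G Mod N\<^esub> = 0"
    using hom_one[OF hh Q.is_group group_integer_group] by simp
  let ?\<phi> = "h \<circ> (\<lambda>x. N #> x)"
  have "?\<phi> \<in> hom G integer_group"
    by (rule Group.hom_compose[OF N.r_coset_hom_Mod hh])
  moreover have "?\<phi> x = 0 \<longleftrightarrow> x \<in> N" if x: "x \<in> carrier G" for x
  proof -
    have c: "N #> x \<in> carrier (G Mod N)" using x by (auto simp: FactGroup_def RCOSETS_def)
    have "?\<phi> x = 0 \<longleftrightarrow> N #> x = \<one>\<^bsub>G Mod N\<^esub>"
      using h1 inj_on_eq_iff[OF inj c Q.one_closed] by simp
    also have "\<dots> \<longleftrightarrow> x \<in> N"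
      using x by (metis N.subgroup_axioms coset_join1 coset_join2 one_FactGroup)
    finally show ?thesis .
  qed
  ultimately show ?thesis by blast
qed

text \<open>A positive cone is built by induction along the series, one infinite cyclic factor at a
  time.\<close>

lemma (in group) poly_Z_imp_left_orderable:
  assumes "poly_Z G"
  shows "left_orderable G"
proof -
  obtain n H where H: "H 0 = {\<one>}" "H n = carrier G" "\<And>i. i \<le> n \<Longrightarrow> subgroup (H i) G"
    "\<And>i. i < n \<Longrightarrow> H i \<lhd> G\<lparr>carrier := H (Suc i)\<rparr>"
    "\<And>i. i < n \<Longrightarrow> G\<lparr>carrier := H (Suc i)\<rparr> Mod H i \<cong> integer_group"
    using assms by (auto simp: poly_Z_def)
  have "\<exists>P \<subseteq> H i. \<one> \<notin> P \<and> (\<forall>x\<in>P. \<forall>y\<in>P. x \<otimes> y \<in> P) \<and> (\<forall>x\<in>H i. x \<noteq> \<one> \<longrightarrow> x \<in> P \<or> inv x \<in> P)"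
    if "i \<le> n" for i
    using that
  proof (induction i)
    case 0
    show ?case using H(1) by (intro exI[of _ "{}"]) auto
  next
    case (Suc i)
    then obtain P where P: "P \<subseteq> H i" "\<one> \<notin> P" "\<forall>x\<in>P. \<forall>y\<in>P. x \<otimes> y \<in> P"
      "\<forall>x\<in>H i. x \<noteq> \<one> \<longrightarrow> x \<in> P \<or> inv x \<in> P" by auto
    let ?M = "G\<lparr>carrier := H (Suc i)\<rparr>"
    have M: "subgroup (H (Suc i)) G" using H(3) Suc.prems by simp
    interpret M: group ?M using M by (rule subgroup_imp_group)
    obtain \<phi> where \<phi>: "\<phi> \<in> hom ?M integer_group" "\<And>x. x \<in> H (Suc i) \<Longrightarrow> \<phi> x = 0 \<longleftrightarrow> x \<in> H i"
      using M.Mod_iso_integer_hom[OF H(4,5)] Suc.prems by auto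
    have mult: "\<phi> (x \<otimes> y) = \<phi> x + \<phi> y" if "x \<in> H (Suc i)" "y \<in> H (Suc i)" for x y
      using hom_mult[OF \<phi>(1)] that by (simp add: integer_group_def)
    have one: "\<phi> \<one> = 0" using mult[of \<one> \<one>] subgroup.one_closed[OF M] by simp
    have invM: "inv x \<in> H (Suc i)" if "x \<in> H (Suc i)" for x
      using M that by (rule subgroup.m_inv_closed)
    have inv: "\<phi> (inv x) = - \<phi> x" if "x \<in> H (Suc i)" for x
      using mult[OF that invM[OF that]] one subgroup.mem_carrier[OF M that] by simp
    have sub: "H i \<subseteq> H (Suc i)"
      using subgroup.subset[OF normal_imp_subgroup[OF H(4)[of i]]] Suc.prems by simp
    have HiG: "subgroup (H i) G" using H(3) Suc.prems by simp
    \<comment> \<open>Lexicographic cone: the sign of \<open>\<phi>\<close> decides first, and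
      \<open>P\<close> decides on the kernel \<open>H i\<close>.\<close>
    define P' where "P' = {x \<in> H (Suc i). \<phi> x > 0} \<union> P"
    have P0: "\<phi> x = 0" "x \<in> H (Suc i)" if "x \<in> P" for x
      using that P(1) sub \<phi>(2) by blast+
    have "P' \<subseteq> H (Suc i)" "\<one> \<notin> P'" using P sub one by (auto simp: P'_def)
    moreover have "x \<otimes> y \<in> P'" if "x \<in> P'" "y \<in> P'" for x y
      using that P(3) P0 subgroup.m_closed[OF M] by (auto simp: P'_def mult)
    moreover have "x \<in> P' \<or> inv x \<in> P'" if "x \<in> H (Suc i)" "x \<noteq> \<one>" for x
      using that P(4) \<phi>(2)[of x] inv[of x] invM[of x] by (cases "\<phi> x" "0::int" rule: linorder_cases) (auto simp: P'_def)
    ultimately show ?case by (intro exI[of _ P']) blast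
  qed
  from this[of n] obtain P where "P \<subseteq> carrier G" "\<one> \<notin> P" "\<forall>x\<in>P. \<forall>y\<in>P. x \<otimes> y \<in> P"
    "\<forall>x\<in>carrier G. x \<noteq> \<one> \<longrightarrow> x \<in> P \<or> inv x \<in> P" using H(2) by auto
  then show ?thesis by (intro cone_imp_left_orderable) auto
qed

section \<open>Extensions of poly-\<open>\<int>\<close> groups\<close>

text \<open>Division with remainder by the least positive element; the trivial subgroup is the case
  \<open>d = 0\<close>.\<close>

lemma integer_subgroup_cyclic:
  assumes "subgroup J integer_group"
  shows "\<exists>d. J = range (\<lambda>k::int. d * k)"
proof (cases "J = {0}")
  case True
  then show ?thesis by (intro exI[of _ 0]) auto
next
  case False
  have J: "0 \<in> J" "\<And>x y. x \<in> J \<Longrightarrow> y \<in> J \<Longrightarrow> x + y \<in> J" "\<And>x. x \<in> J \<Longrightarrow> - x \<in> J"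
    using subgroup.one_closed[OF assms] subgroup.m_closed[OF assms]
      subgroup.m_inv_closed[OF assms] by simp_all
  obtain x where x: "x \<in> J" "x \<noteq> 0" using False J(1) by auto
  then have "\<exists>n::nat. 0 < n \<and> int n \<in> J"
    using J(3)[of x] by (intro exI[of _ "nat \<bar>x\<bar>"]) (auto simp: abs_if)
  define d where "d = (LEAST n::nat. 0 < n \<and> int n \<in> J)"
  have d: "0 < d" "int d \<in> J" and least: "\<And>n. 0 < n \<Longrightarrow> int n \<in> J \<Longrightarrow> d \<le> n"
    using LeastI_ex[OF \<open>\<exists>n::nat. 0 < n \<and> int n \<in> J\<close>]
    by (auto simp: d_def intro: Least_le)
  have nat_mult: "int d * int k \<in> J" for k
    using d J by (induction k) (auto simp: algebra_simps)
  have mult: "int d * k \<in> J" for k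
  proof (cases "k \<ge> 0")
    case True
    then show ?thesis using nat_mult[of "nat k"] by simp
  next
    case False
    then show ?thesis using J(3)[OF nat_mult[of "nat (- k)"]] by simp
  qed
  have "y \<in> range (\<lambda>k. int d * k)" if y: "y \<in> J" for y
  proof -
    have "y + int d * (- (y div int d)) \<in> J" using y mult J(2) by blast
    moreover have "y + int d * (- (y div int d)) = y mod int d"
      by (simp add: minus_mult_div_eq_mod[symmetric])
    ultimately have "y mod int d \<in> J" by simp
    moreover have "0 \<le> y mod int d" "y mod int d < int d" using d by simp_all
    ultimately have "y mod int d = 0"
      using least[of "nat (y mod int d)"] by (cases "y mod int d = 0") auto
    then show ?thesis by (metis mult_div_mod_eq add.right_neutral rangeI)
  qed
  then show ?thesis using mult by (intro exI[of _ "int d"]) auto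
qed

text \<open>The image of \<open>\<phi>\<close> consists of the multiples of some \<open>d\<close>.
  For \<open>d = 0\<close> the kernel is \<open>M\<close>; otherwise division by \<open>d\<close>
  gives a surjection with the same kernel, and \<open>M\<close> is appended to the series of that
  kernel.\<close>

lemma (in group) poly_Z_integer_extension:
  assumes M: "subgroup M G" and \<phi>: "\<phi> \<in> hom (G\<lparr>carrier := M\<rparr>) integer_group"
    and poly: "poly_Z (G\<lparr>carrier := {x \<in> M. \<phi> x = 0}\<rparr>)"
  shows "poly_Z (G\<lparr>carrier := M\<rparr>)"
proof -
  let ?M = "G\<lparr>carrier := M\<rparr>" and ?N = "{x \<in> M. \<phi> x = 0}"
  interpret M: group ?M using M by (rule subgroup_imp_group)
  interpret \<phi>: group_hom ?M integer_group \<phi>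
    using \<phi> by (intro group_hom.intro group_hom_axioms.intro M.is_group group_integer_group)
  have ker: "kernel ?M integer_group \<phi> = ?N" by (simp add: kernel_def)
  have N: "subgroup ?N G"
    using \<phi>.subgroup_kernel unfolding ker by (rule incl_subgroup[OF M])
  obtain d where d: "\<phi> ` M = range (\<lambda>k. d * k)"
    using integer_subgroup_cyclic[OF \<phi>.img_is_subgroup] by auto
  show ?thesis
  proof (cases "d = 0")
    case True
    then have "?N = M" using d by auto
    then show ?thesis using poly by simp
  next
    case False
    define \<psi> where "\<psi> x = \<phi> x div d" for x
    have \<phi>_eq: "\<phi> x = d * \<psi> x" if "x \<in> M" for x
    proof -
      have "\<phi> x \<in> range (\<lambda>k. d * k)" using d that by blast
      then show ?thesis by (auto simp: \<psi>_def)
    qed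
    have "\<psi> \<in> hom ?M integer_group"
    proof (rule homI)
      fix x y assume "x \<in> carrier ?M" "y \<in> carrier ?M"
      then have "d * \<psi> (x \<otimes> y) = d * (\<psi> x + \<psi> y)"
        using hom_mult[OF \<phi>, of x y] \<phi>_eq subgroup.m_closed[OF M]
        by (simp add: algebra_simps)
      then show "\<psi> (x \<otimes>\<^bsub>?M\<^esub> y) = \<psi> x \<otimes>\<^bsub>integer_group\<^esub> \<psi> y" using False by simp
    qed simp
    then interpret \<psi>: group_hom ?M integer_group \<psi>
      by (intro group_hom.intro group_hom_axioms.intro M.is_group group_integer_group)
    have ker': "kernel ?M integer_group \<psi> = ?N" using \<phi>_eq False by (auto simp: kernel_def)
    have "k \<in> \<psi> ` M" for k
    proof -
      have "d * k \<in> \<phi> ` M" using d by auto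
      then show ?thesis using \<phi>_eq False by auto
    qed
    then have "?M Mod ?N \<cong> integer_group"
      using \<psi>.FactGroup_iso unfolding ker' by auto
    moreover have "?N \<lhd> ?M" using \<psi>.normal_kernel unfolding ker' .
    moreover obtain n H where H: "H 0 = {\<one>}" "H n = ?N"
      "\<forall>i\<le>n. subgroup (H i) (G\<lparr>carrier := ?N\<rparr>)"
      "\<forall>i<n. H i \<lhd> G\<lparr>carrier := H (Suc i)\<rparr> \<and> G\<lparr>carrier := H (Suc i)\<rparr> Mod H i \<cong> integer_group"
      using poly by (auto simp: poly_Z_def)
    moreover have "subgroup (H i) ?M" if "i \<le> n" for i
    proof -
      have "subgroup (H i) G" using H(3) that incl_subgroup[OF N] by blast
      moreover have "H i \<subseteq> M" using H(3) that subgroup.subset by fastforce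
      ultimately show ?thesis using M by (simp add: subgroup_incl)
    qed
    moreover define H' where "H' = H(Suc n := M)"
    ultimately have "H' 0 = {\<one>}" "H' (Suc n) = M"
      "\<And>i. i \<le> Suc n \<Longrightarrow> subgroup (H' i) ?M"
      "\<And>i. i < Suc n \<Longrightarrow> H' i \<lhd> G\<lparr>carrier := H' (Suc i)\<rparr> \<and>
        G\<lparr>carrier := H' (Suc i)\<rparr> Mod H' i \<cong> integer_group"
      using M.subgroup_self by (simp_all add: less_Suc_eq le_Suc_eq split: if_splits) fastforce+
    then show ?thesis
      unfolding poly_Z_def by (intro exI[of _ "Suc n"] exI[of _ H']) simp
  qed
qed

text \<open>Passes to one kernel after another, so a free abelian quotient is handled coordinate by
  coordinate without determining its rank.\<close>

lemma (in group) poly_Z_integer_family_extension: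
  assumes "finite I" "subgroup M G" "\<And>i. i \<in> I \<Longrightarrow> \<phi> i \<in> hom (G\<lparr>carrier := M\<rparr>) integer_group"
    and "poly_Z (G\<lparr>carrier := {x \<in> M. \<forall>i\<in>I. \<phi> i x = 0}\<rparr>)"
  shows "poly_Z (G\<lparr>carrier := M\<rparr>)"
  using assms
proof (induction I arbitrary: M rule: finite_induct)
  case (insert i I)
  let ?N = "{x \<in> M. \<phi> i x = 0}"
  interpret \<phi>: group_hom "G\<lparr>carrier := M\<rparr>" integer_group "\<phi> i"
    using insert.prems
    by (intro group_hom.intro group_hom_axioms.intro subgroup_imp_group group_integer_group) auto
  have "kernel (G\<lparr>carrier := M\<rparr>) integer_group (\<phi> i) = ?N" by (simp add: kernel_def)
  then have N: "subgroup ?N G"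
    using \<phi>.subgroup_kernel incl_subgroup[OF insert.prems(1)] by metis
  have "\<phi> j \<in> hom (G\<lparr>carrier := ?N\<rparr>) integer_group" if "j \<in> I" for j
    using insert.prems(2)[of j] that by (auto simp: hom_def)
  moreover have "{x \<in> ?N. \<forall>j\<in>I. \<phi> j x = 0} = {x \<in> M. \<forall>j\<in>insert i I. \<phi> j x = 0}" by auto
  ultimately have "poly_Z (G\<lparr>carrier := ?N\<rparr>)"
    using insert.prems(3) insert.IH[OF N] by simp
  then show ?case
    by (rule poly_Z_integer_extension[OF insert.prems(1) insert.prems(2)[OF insertI1]])
qed simp

section \<open>Integer vectors\<close>

definition unit_vec :: "'a \<Rightarrow> 'a \<Rightarrow> int" where
  "unit_vec x = (\<lambda>y. if y = x then 1 else 0)"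

lemma sum_unit_vec: "finite A \<Longrightarrow> (\<Sum>y\<in>A. unit_vec x y) = (if x \<in> A then 1 else 0)"
  by (simp add: unit_vec_def)

text \<open>Vectors with vanishing class sums are generated by differences of unit vectors at
  equivalent points. The induction is on the sum of the absolute values of the entries.\<close>

lemma zero_class_sums_induct [consumes 4, case_names zero step]:
  assumes "finite X" "equiv X E" "\<And>x. x \<notin> X \<Longrightarrow> a x = 0"
    and "\<And>x. x \<in> X \<Longrightarrow> (\<Sum>y\<in>E `` {x}. a y) = 0"
    and zero: "P (\<lambda>_. 0)"
    and step: "\<And>a x y. \<lbrakk>P a; \<And>z. z \<notin> X \<Longrightarrow> a z = 0; (x, y) \<in> E\<rbrakk>
      \<Longrightarrow> P (\<lambda>z. a z + unit_vec x z - unit_vec y z)"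
  shows "P (a :: 'a \<Rightarrow> int)"
proof -
  have EX: "E \<subseteq> X \<times> X" using assms(2) by (rule equiv_type)
  show ?thesis using assms(3,4)
  proof (induction "nat (\<Sum>x\<in>X. \<bar>a x\<bar>)" arbitrary: a rule: less_induct)
    case less
    show ?case
    proof (cases "\<forall>x\<in>X. a x = 0")
      case True
      then have "a = (\<lambda>_. 0)" using less.prems by blast
      then show ?thesis using zero by simp
    next
      case False
      then obtain w where w: "w \<in> X" "a w \<noteq> 0" by auto
      let ?C = "E `` {w}"
      have C: "?C \<subseteq> X" "w \<in> ?C" "finite ?C" "(\<Sum>y\<in>?C. a y) = 0"
        using w EX less.prems(2) equiv_class_self[OF assms(2) w(1)]
        by (auto intro: finite_subset[OF _ assms(1)])
      have "\<exists>x\<in>?C. a x > 0"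
      proof (rule ccontr)
        assume "\<not> ?thesis"
        then have "\<forall>x\<in>?C. - a x = 0"
          using C by (subst sum_nonneg_eq_0_iff[symmetric]) (auto simp: sum_negf not_less)
        then show False using w C by auto
      qed
      moreover have "\<exists>x\<in>?C. a x < 0"
      proof (rule ccontr)
        assume "\<not> ?thesis"
        then have "\<forall>x\<in>?C. a x = 0"
          using C by (subst sum_nonneg_eq_0_iff[symmetric]) (auto simp: not_less)
        then show False using w C by auto
      qed
      ultimately obtain x y where xy: "x \<in> ?C" "a x > 0" "y \<in> ?C" "a y < 0" by blast
      then have E: "(x, y) \<in> E" and xyX: "x \<in> X" "y \<in> X" and ne: "x \<noteq> y"
        using C assms(2) by (auto elim!: equivE dest: symD transD)
      \<comment> \<open>Moves one unit from a positive entry to a negative entry of the same class,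
        which lowers the sum of absolute values by 2.\<close>
      define b where "b z = a z - unit_vec x z + unit_vec y z" for z
      have "(\<Sum>z\<in>X. \<bar>b z\<bar>) < (\<Sum>z\<in>X. \<bar>a z\<bar>)"
        using assms(1) xy xyX ne
        by (intro sum_strict_mono_ex1) (auto simp: b_def unit_vec_def intro!: bexI[of _ x])
      then have "nat (\<Sum>z\<in>X. \<bar>b z\<bar>) < nat (\<Sum>z\<in>X. \<bar>a z\<bar>)"
        using sum_nonneg[of X "\<lambda>z. \<bar>b z\<bar>"] by linarith
      moreover have b0: "b z = 0" if "z \<notin> X" for z
        using that less.prems(1) xyX by (auto simp: b_def unit_vec_def)
      moreover have "(\<Sum>z\<in>E `` {v}. b z) = 0" if "v \<in> X" for v
      proof -
        have "x \<in> E `` {v} \<longleftrightarrow> y \<in> E `` {v}"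
          using E assms(2) by (auto elim!: equivE dest: symD transD)
        moreover have "finite (E `` {v})"
          using EX by (auto intro: finite_subset[OF _ assms(1)])
        ultimately show ?thesis
          using less.prems(2)[OF that] by (simp add: b_def sum.distrib sum_subtractf sum_unit_vec)
      qed
      ultimately have "P b" using less.hyps by blast
      then have "P (\<lambda>z. b z + unit_vec x z - unit_vec y z)" using b0 E by (rule step)
      then show ?thesis by (simp add: b_def)
  qed
qed
qed

section \<open>Actions of \<open>\<int>\<^sup>X\<close> by commuting bijections\<close>

definition int_iter :: "('a \<Rightarrow> 'a) \<Rightarrow> int \<Rightarrow> 'a \<Rightarrow> 'a" where
  "int_iter f n = (if 0 \<le> n then f ^^ nat n else (inv_into UNIV f) ^^ nat (- n))"

lemma int_iter_add_one:
  assumes "bij f"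
  shows "int_iter f (n + 1) = f \<circ> int_iter f n"
proof (cases "0 \<le> n")
  case True
  then show ?thesis by (simp add: int_iter_def nat_add_distrib)
next
  case False
  define m where "m = nat (- n - 1)"
  then have n: "n = - int (Suc m)" using False by auto
  have "f \<circ> inv_into UNIV f = id" using assms by (intro surj_iff[THEN iffD1] bij_is_surj)
  then have "f \<circ> (inv_into UNIV f ^^ Suc m) = inv_into UNIV f ^^ m" by (simp add: o_assoc)
  then show ?thesis by (cases m) (simp_all add: int_iter_def n nat_add_distrib)
qed

lemma int_iter_commute:
  assumes "bij f" "f \<circ> g = g \<circ> f"
  shows "int_iter f n \<circ> g = g \<circ> int_iter f n"
proof -
  have "(h ^^ k) \<circ> g = g \<circ> (h ^^ k)" if "h \<circ> g = g \<circ> h" for h :: "'a \<Rightarrow> 'a" and k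
  proof
    have "h (g x) = g (h x)" for x using fun_cong[OF that] by simp
    then show "((h ^^ k) \<circ> g) x = (g \<circ> (h ^^ k)) x" for x
      by (induction k) simp_all
  qed
  moreover have "inv_into UNIV f \<circ> g = g \<circ> inv_into UNIV f"
  proof
    fix x
    have "f (g (inv_into UNIV f x)) = g x"
      using assms by (metis bij_inv_eq_iff comp_apply)
    then show "(inv_into UNIV f \<circ> g) x = (g \<circ> inv_into UNIV f) x"
      using assms(1) by (metis bij_inv_eq_iff comp_apply)
  qed
  ultimately show ?thesis using assms(2) by (simp add: int_iter_def)
qed

text \<open>\<open>act a\<close> is the composite of the powers of the \<open>T x\<close> with
  exponents \<open>a x\<close>; commutativity makes the order of the factors immaterial.\<close>

lemma commuting_bijections_action:
  assumes "finite X" "\<And>x. x \<in> X \<Longrightarrow> bij (T x)"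
    and "\<And>x y. x \<in> X \<Longrightarrow> y \<in> X \<Longrightarrow> T x \<circ> T y = T y \<circ> T x"
  shows "\<exists>act :: ('a \<Rightarrow> int) \<Rightarrow> 'b \<Rightarrow> 'b. act (\<lambda>_. 0) = id \<and>
    (\<forall>a. \<forall>x\<in>X. act (\<lambda>z. a z + unit_vec x z) = T x \<circ> act a)"
proof -
  \<comment> \<open>The extra clause, that \<open>act\<close> sees only the coordinates in
    \<open>X\<close>, carries the induction: the exponent of a new point can be changed without
    disturbing the part already built.\<close>
  have "\<exists>act :: ('a \<Rightarrow> int) \<Rightarrow> 'b \<Rightarrow> 'b. act (\<lambda>_. 0) = id \<and>
    (\<forall>a. \<forall>x\<in>X. act (\<lambda>z. a z + unit_vec x z) = T x \<circ> act a) \<and>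
    (\<forall>a b. (\<forall>x\<in>X. a x = b x) \<longrightarrow> act a = act b)"
    using assms
  proof (induction X rule: finite_induct)
    case empty
    then show ?case by (intro exI[of _ "\<lambda>_. id"]) auto
  next
    case (insert y X)
    have "\<exists>act :: ('a \<Rightarrow> int) \<Rightarrow> 'b \<Rightarrow> 'b. act (\<lambda>_. 0) = id \<and>
      (\<forall>a. \<forall>x\<in>X. act (\<lambda>z. a z + unit_vec x z) = T x \<circ> act a) \<and>
      (\<forall>a b. (\<forall>x\<in>X. a x = b x) \<longrightarrow> act a = act b)"
      by (rule insert.IH) (simp_all add: insert.prems)
    then obtain act :: "('a \<Rightarrow> int) \<Rightarrow> 'b \<Rightarrow> 'b" where act: "act (\<lambda>_. 0) = id"
      "\<And>a x. x \<in> X \<Longrightarrow> act (\<lambda>z. a z + unit_vec x z) = T x \<circ> act a"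
      "\<And>a b. (\<And>x. x \<in> X \<Longrightarrow> a x = b x) \<Longrightarrow> act a = act b" by blast
    define act' where "act' a = int_iter (T y) (a y) \<circ> act a" for a
    have "act' (\<lambda>_. 0) = id" by (simp add: act'_def act(1) int_iter_def)
    moreover have "act' (\<lambda>z. a z + unit_vec x z) = T x \<circ> act' a" if "x \<in> insert y X" for a x
    proof (cases "x = y")
      case True
      have "act (\<lambda>z. a z + unit_vec x z) = act a"
        using insert.hyps(2) True by (intro act(3)) (auto simp: unit_vec_def)
      then show ?thesis
        using insert.prems(1)[of y] True
        by (simp add: act'_def unit_vec_def int_iter_add_one o_assoc)
    next
      case False
      have "int_iter (T y) (a y) \<circ> T x = T x \<circ> int_iter (T y) (a y)"
        using False that by (intro int_iter_commute insert.prems) auto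
      moreover have "unit_vec x y = 0" "x \<in> X" using False that by (auto simp: unit_vec_def)
      ultimately show ?thesis by (simp add: act'_def act(2) o_assoc)
    qed
    moreover have "act' a = act' b" if "\<forall>x\<in>insert y X. a x = b x" for a b
      using that act(3)[of a b] by (simp add: act'_def)
    ultimately show ?case by (intro exI[of _ act']) blast
  qed
  then show ?thesis by blast
qed

text \<open>A class of the coarser relation is a disjoint union of classes of the finer one.\<close>

lemma zero_class_sums_coarser:
  assumes "finite X" "equiv X E" "equiv X F" "F \<subseteq> E"
    and F: "\<And>x. x \<in> X \<Longrightarrow> (\<Sum>y\<in>F `` {x}. a y) = 0" and x: "x \<in> X"
  shows "(\<Sum>y\<in>E `` {x}. a y) = (0 :: int)"
proof -
  let ?C = "E `` {x}"
  have CX: "?C \<subseteq> X" using equiv_type[OF assms(2)] by blast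
  then have "finite ?C" using finite_subset[OF _ assms(1)] by blast
  then have "(\<Sum>y\<in>?C. a y) = (\<Sum>K\<in>(\<lambda>y. F `` {y}) ` ?C. \<Sum>y | y \<in> ?C \<and> F `` {y} = K. a y)"
    by (rule sum.image_gen)
  also have "\<dots> = 0"
  proof (rule sum.neutral, safe)
    fix y assume y: "(x, y) \<in> E"
    then have yX: "y \<in> X" using CX by blast
    have "{z. z \<in> ?C \<and> F `` {z} = F `` {y}} = F `` {y}"
    proof (intro equalityI subsetI)
      fix z assume "z \<in> {z. z \<in> ?C \<and> F `` {z} = F `` {y}}"
      then show "z \<in> F `` {y}" using equiv_class_self[OF assms(3)] CX by blast
    next
      fix z assume z: "z \<in> F `` {y}"
      then have "(x, z) \<in> E" using y assms(2,4) by (auto elim!: equivE dest: transD)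
      then show "z \<in> {z. z \<in> ?C \<and> F `` {z} = F `` {y}}"
        using z equiv_class_eq[OF assms(3)] by auto
    qed
    then show "(\<Sum>z | z \<in> ?C \<and> F `` {z} = F `` {y}. a z) = 0" using F[OF yX] by simp
  qed
  finally show ?thesis .
qed

section \<open>Iterated retractions\<close>

text \<open>\<open>p\<close> acts injectively on the finite relation \<open>R\<close>, hence onto
  it.\<close>

lemma permutes_inv_preserves:
  assumes "finite R" "p permutes X" "\<And>x y. (x, y) \<in> R \<Longrightarrow> (p x, p y) \<in> R" "(x, y) \<in> R"
  shows "(inv_into UNIV p x, inv_into UNIV p y) \<in> R"
proof -
  have "inj p" using assms(2) by (rule permutes_inj)
  then have "map_prod p p ` R = R"
    using assms(1,3) by (intro endo_inj_surj) (auto simp: inj_on_def)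
  then have "(x, y) \<in> map_prod p p ` R" using assms(4) by simp
  then obtain u v where "(u, v) \<in> R" "x = p u" "y = p v" by auto
  then show ?thesis using \<open>inj p\<close> by simp
qed

locale finite_solution =
  fixes X :: "'a set" and r :: "'a \<times> 'a \<Rightarrow> 'a \<times> 'a"
  assumes finite: "finite X"
    and solution: "ybe_solution (X, r)"
    and non_degenerate: "non_degenerate (X, r)"
    and involutive: "involutive (X, r)"
begin

text \<open>Extending \<open>sigma\<close> by the identity makes every \<open>s x\<close> a
  permutation in the sense of \<open>permutes\<close>, also for \<open>x\<close> outside
  \<open>X\<close>.\<close>

definition s :: "'a \<Rightarrow> 'a \<Rightarrow> 'a" where
  "s x y = (if x \<in> X \<and> y \<in> X then sigma r x y else y)"

lemma r_eq: "r (x, y) = (sigma r x y, gamma r y x)"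
  by (simp add: sigma_def gamma_def)

lemma s_eq: "x \<in> X \<Longrightarrow> y \<in> X \<Longrightarrow> s x y = sigma r x y"
  by (simp add: s_def)

lemma s_permutes: "s x permutes X"
proof (cases "x \<in> X")
  case True
  have "bij_betw (sigma r x) X X" using non_degenerate True by (simp add: non_degenerate_def)
  then have "bij_betw (s x) X X"
    by (rule bij_betw_cong[THEN iffD1, rotated]) (simp add: s_def True)
  then show ?thesis by (rule bij_imp_permutes) (simp add: s_def)
next
  case False
  then have "s x = id" by (auto simp: s_def)
  then show ?thesis by (simp add: permutes_id)
qed

lemma s_in_X [simp]: "s x y \<in> X \<longleftrightarrow> y \<in> X"
  using s_permutes by (rule permutes_in_image)

lemma gamma_in_X: "x \<in> X \<Longrightarrow> y \<in> X \<Longrightarrow> gamma r y x \<in> X"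
  using non_degenerate by (auto simp: non_degenerate_def bij_betw_def)

text \<open>Rump's cycle set operation.\<close>

definition cdot :: "'a \<Rightarrow> 'a \<Rightarrow> 'a" where
  "cdot x = inv_into UNIV (s x)"

lemma cdot_permutes: "cdot x permutes X"
  unfolding cdot_def using s_permutes by (rule permutes_inv)

lemma cdot_in_X [simp]: "cdot x y \<in> X \<longleftrightarrow> y \<in> X"
  using cdot_permutes by (rule permutes_in_image)

lemma s_cdot [simp]: "s x (cdot x y) = y"
  unfolding cdot_def using s_permutes by (rule permutes_inverses)

lemma cdot_s [simp]: "cdot x (s x y) = y"
  unfolding cdot_def using s_permutes by (rule permutes_inverses)

text \<open>First component of \<open>r (r (x, y)) = (x, y)\<close>.\<close>

lemma s_gamma:
  assumes "x \<in> X" "y \<in> X"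
  shows "s (s x y) (gamma r y x) = x"
proof -
  have "r (r (x, y)) = (x, y)" using involutive assms by (simp add: involutive_def)
  then show ?thesis using assms gamma_in_X[OF assms] s_in_X[of x y]
    by (simp add: s_eq r_eq)
qed

lemma gamma_eq: "x \<in> X \<Longrightarrow> y \<in> X \<Longrightarrow> gamma r y x = cdot (s x y) x"
  using s_gamma cdot_s by metis

text \<open>First component of the braid relation at (x, y, z).\<close>

lemma s_mult:
  assumes "x \<in> X" "y \<in> X"
  shows "s x \<circ> s y = s (s x y) \<circ> s (gamma r y x)"
proof
  fix z
  show "(s x \<circ> s y) z = (s (s x y) \<circ> s (gamma r y x)) z"
  proof (cases "z \<in> X")
    case True
    have "r12 r (r23 r (r12 r (x, y, z))) = r23 r (r12 r (r23 r (x, y, z)))"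
      using solution assms True by (simp add: ybe_solution_def)
    then have "sigma r (sigma r x y) (sigma r (gamma r y x) z) = sigma r x (sigma r y z)"
      by (simp add: r12_def r23_def r_eq)
    then show ?thesis
      using assms True gamma_in_X[OF assms] s_in_X[of x y] s_in_X[of y z] s_in_X[of "gamma r y x" z]
      by (simp add: s_eq)
  qed (simp add: s_def)
qed

text \<open>\<open>s_mult\<close> with \<open>cdot x y\<close> in place of \<open>y\<close>, which
  makes the relation symmetric in \<open>x\<close> and \<open>y\<close>.\<close>

lemma s_cdot_commute:
  assumes "x \<in> X" "y \<in> X"
  shows "s x \<circ> s (cdot x y) = s y \<circ> s (cdot y x)"
  using s_mult[of x "cdot x y"] gamma_eq[of x "cdot x y"] assms by simp

text \<open>The cycle set identity of Rump.\<close>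

lemma cdot_cdot:
  assumes "x \<in> X" "y \<in> X"
  shows "cdot (cdot x y) (cdot x z) = cdot (cdot y x) (cdot y z)"
proof -
  have "s x (s (cdot x y) (cdot (cdot y x) (cdot y z))) = z"
    using fun_cong[OF s_cdot_commute[OF assms], of "cdot (cdot y x) (cdot y z)"] by simp
  then show ?thesis by (metis cdot_s)
qed

text \<open>If c = \<open>cdot z z\<close>, then \<open>gamma r c z = c\<close>; two such z coincide
  because \<open>gamma r c\<close> is injective. This is what makes \<open>add_gen\<close> a
  bijection later.\<close>

lemma cdot_self_inj: "inj_on (\<lambda>x. cdot x x) X"
proof (rule inj_onI)
  fix x y assume x: "x \<in> X" and y: "y \<in> X" and eq: "cdot x x = cdot y y"
  have "gamma r (cdot z z) z = cdot z z" if "z \<in> X" for z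
    using that by (simp add: gamma_eq)
  then have "gamma r (cdot x x) x = gamma r (cdot x x) y"
    using x y eq by metis
  moreover have "inj_on (gamma r (cdot x x)) X"
    using non_degenerate x by (simp add: non_degenerate_def bij_betw_def)
  ultimately show "x = y" using x y by (simp add: inj_on_eq_iff)
qed

text \<open>The kernels \<open>E\<^sub>n\<close> of the iterated retractions, written on
  \<open>X\<close> itself so that the arguments about the group form no quotient;
  \<open>Ret_funpow\<close> justifies the recursion.\<close>

primrec ret_eq :: "nat \<Rightarrow> ('a \<times> 'a) set" where
  "ret_eq 0 = Id_on X"
| "ret_eq (Suc n) = {(x, y). x \<in> X \<and> y \<in> X \<and> (\<forall>z\<in>X. (s x z, s y z) \<in> ret_eq n)}"

lemma equiv_ret_eq: "equiv X (ret_eq n)"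
proof (induction n)
  case 0
  show ?case by (auto simp: equiv_def refl_on_def sym_def trans_def)
next
  case (Suc n)
  show ?case
  proof (rule equivI)
    show "refl_on X (ret_eq (Suc n))" using Suc by (auto simp: equiv_def refl_on_def)
    show "sym (ret_eq (Suc n))" using Suc by (auto simp: equiv_def sym_def)
    show "trans (ret_eq (Suc n))" using Suc unfolding equiv_def trans_def by simp blast
  qed auto
qed

lemma ret_eq_subset: "ret_eq n \<subseteq> X \<times> X"
  using equiv_type[OF equiv_ret_eq] .

lemma ret_eq_refl: "x \<in> X \<Longrightarrow> (x, x) \<in> ret_eq n"
  using equiv_ret_eq[of n] by (auto simp: equiv_def refl_on_def)

lemma ret_eq_sym: "(x, y) \<in> ret_eq n \<Longrightarrow> (y, x) \<in> ret_eq n"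
  using equiv_ret_eq[of n] by (auto simp: equiv_def dest: symD)

lemma ret_eq_trans: "(x, y) \<in> ret_eq n \<Longrightarrow> (y, z) \<in> ret_eq n \<Longrightarrow> (x, z) \<in> ret_eq n"
  using equiv_ret_eq[of n] by (auto simp: equiv_def dest: transD)

lemma finite_ret_eq: "finite (ret_eq n)"
  using finite_subset[OF ret_eq_subset] finite by blast

lemma ret_eq_Suc: "ret_eq n \<subseteq> ret_eq (Suc n)"
proof (induction n)
  case 0
  show ?case by (auto intro: Id_onI)
next
  case (Suc n)
  show ?case
  proof (rule subrelI)
    fix x y assume "(x, y) \<in> ret_eq (Suc n)"
    then show "(x, y) \<in> ret_eq (Suc (Suc n))"
      using Suc by (subst ret_eq.simps(2)) (auto simp del: ret_eq.simps(2) simp: ret_eq.simps(2)[of n])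
  qed
qed

text \<open>Two permutations that, like their inverses, preserve \<open>E\<^sub>n\<close> agree
  modulo \<open>E\<^sub>n\<close> exactly when their inverses do. The form with inverses is the one
  to which the cycle set identity applies.\<close>

lemma ret_eq_Suc_cdot:
  assumes inv: "\<And>x y z. (y, z) \<in> ret_eq n \<Longrightarrow> (s x y, s x z) \<in> ret_eq n"
    "\<And>x y z. (y, z) \<in> ret_eq n \<Longrightarrow> (cdot x y, cdot x z) \<in> ret_eq n"
    and "x \<in> X" "y \<in> X"
  shows "(x, y) \<in> ret_eq (Suc n) \<longleftrightarrow> (\<forall>z\<in>X. (cdot x z, cdot y z) \<in> ret_eq n)"
proof
  assume xy: "(x, y) \<in> ret_eq (Suc n)"
  show "\<forall>z\<in>X. (cdot x z, cdot y z) \<in> ret_eq n"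
  proof
    fix z assume "z \<in> X"
    then have "cdot y z \<in> X" by simp
    then have "(s x (cdot y z), s y (cdot y z)) \<in> ret_eq n" using xy by (simp only: ret_eq.simps) blast
    then have "(cdot x (s x (cdot y z)), cdot x z) \<in> ret_eq n" using inv(2) by fastforce
    then show "(cdot x z, cdot y z) \<in> ret_eq n" by (simp add: ret_eq_sym)
  qed
next
  assume xy: "\<forall>z\<in>X. (cdot x z, cdot y z) \<in> ret_eq n"
  have "(s x z, s y z) \<in> ret_eq n" if "z \<in> X" for z
  proof -
    have "s y z \<in> X" using that by simp
    then have "(cdot x (s y z), cdot y (s y z)) \<in> ret_eq n" using xy by blast
    then have "(s x (cdot x (s y z)), s x z) \<in> ret_eq n" using inv(1) by fastforce
    then show ?thesis by (simp add: ret_eq_sym)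
  qed
  then show "(x, y) \<in> ret_eq (Suc n)" using assms by simp
qed

text \<open>Write x.y for \<open>cdot x y\<close>. If y and z are related at stage n+1, the cycle
  set identity gives, modulo \<open>E\<^sub>n\<close>, (x.y).(x.w) = (y.x).(y.w) = (z.x).(z.w) =
  (x.z).(x.w), and every point has the form x.w. Invariance under \<open>s x\<close> then follows by
  finiteness.\<close>

lemma ret_eq_s_cdot:
  "(y, z) \<in> ret_eq n \<Longrightarrow> (s x y, s x z) \<in> ret_eq n \<and> (cdot x y, cdot x z) \<in> ret_eq n"
proof (induction n arbitrary: x y z)
  case 0
  then show ?case by auto
next
  case (Suc n)
  have E: "(x, y) \<in> ret_eq (Suc n) \<longleftrightarrow> (\<forall>z\<in>X. (cdot x z, cdot y z) \<in> ret_eq n)"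
    if "x \<in> X" "y \<in> X" for x y
    using that Suc.IH by (intro ret_eq_Suc_cdot) auto
  \<comment> \<open>Since \<open>E\<^sub>n\<close> is contained in the next relation, related left
    arguments may be exchanged as well.\<close>
  have cong: "(cdot u v, cdot u' v') \<in> ret_eq n" if "(u, u') \<in> ret_eq n" "(v, v') \<in> ret_eq n" for u u' v v'
  proof -
    have X: "u \<in> X" "u' \<in> X" "v \<in> X" using that ret_eq_subset by auto
    have "(u, u') \<in> ret_eq (Suc n)" using that ret_eq_Suc by blast
    then have "(cdot u v, cdot u' v) \<in> ret_eq n" using E X by blast
    then show ?thesis using Suc.IH[OF that(2)] ret_eq_trans by blast
  qed
  have *: "(cdot x y, cdot x z) \<in> ret_eq (Suc n)" if yz: "(y, z) \<in> ret_eq (Suc n)" for x y z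
  proof (cases "x \<in> X")
    case True
    have X: "y \<in> X" "z \<in> X" using that ret_eq_subset[of "Suc n"] by blast+
    have yz': "(cdot y w, cdot z w) \<in> ret_eq n" if "w \<in> X" for w using E[OF X] yz that by blast
    have "(cdot (cdot x y) w, cdot (cdot x z) w) \<in> ret_eq n" if "w \<in> X" for w
    proof -
      have "(cdot (cdot x y) (cdot x (s x w)), cdot (cdot x z) (cdot x (s x w))) \<in> ret_eq n"
        unfolding cdot_cdot[OF True X(1)] cdot_cdot[OF True X(2)]
        using True that by (intro cong yz') auto
      then show ?thesis by simp
    qed
    then show ?thesis using E X by simp
  next
    case False
    then have "s x = id" by (auto simp: s_def)
    then show ?thesis using yz by (simp add: cdot_def)
  qed
  have "s x = inv_into UNIV (cdot x)"
    using permutes_inv_inv[OF s_permutes[of x]] by (simp add: cdot_def)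
  then have "(s x y, s x z) \<in> ret_eq (Suc n)"
    using permutes_inv_preserves[OF finite_ret_eq cdot_permutes * Suc.prems] by simp
  then show ?case using *[OF Suc.prems] by blast
qed

lemma ret_eq_s: "(y, z) \<in> ret_eq n \<Longrightarrow> (s x y, s x z) \<in> ret_eq n"
  and ret_eq_cdot: "(y, z) \<in> ret_eq n \<Longrightarrow> (cdot x y, cdot x z) \<in> ret_eq n"
  using ret_eq_s_cdot by blast+

lemma ret_eq_s_cong:
  assumes "(u, u') \<in> ret_eq n" "(v, v') \<in> ret_eq n"
  shows "(s u v, s u' v') \<in> ret_eq n"
proof -
  have "(u, u') \<in> ret_eq (Suc n)" using assms ret_eq_Suc by blast
  moreover have "v \<in> X" using assms(2) ret_eq_subset by blast
  ultimately have "(s u v, s u' v) \<in> ret_eq n" by simp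
  then show ?thesis using ret_eq_s[OF assms(2)] ret_eq_trans by blast
qed

lemma ret_eq_gamma_cong:
  assumes "(u, u') \<in> ret_eq n" "(v, v') \<in> ret_eq n"
  shows "(gamma r v u, gamma r v' u') \<in> ret_eq n"
proof -
  have X: "u \<in> X" "u' \<in> X" "v \<in> X" "v' \<in> X" using assms ret_eq_subset by blast+
  \<comment> \<open>By \<open>gamma_eq\<close> both sides are values of \<open>cdot\<close> with
    left arguments \<open>s u v\<close> and \<open>s u' v'\<close>; related at stage n+1, these may
    be exchanged modulo stage n.\<close>
  have "(s u v, s u' v') \<in> ret_eq (Suc n)" using ret_eq_s_cong[OF assms] ret_eq_Suc by blast
  then have "(cdot (s u v) u, cdot (s u' v') u) \<in> ret_eq n"
    using X ret_eq_s ret_eq_cdot by (subst (asm) ret_eq_Suc_cdot) auto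
  then show ?thesis using ret_eq_cdot[OF assms(1)] ret_eq_trans X by (simp add: gamma_eq)
qed

section \<open>Comparison with the iterated retraction\<close>

text \<open>\<open>p\<close> is the projection of \<open>X\<close> onto the n-th retraction. Its
  compatibility with the solution maps is carried along because the next retraction is defined from
  them.\<close>

lemma Ret_funpow:
  "\<exists>p. p ` X = fst ((Ret ^^ n) (X, r)) \<and> (\<forall>x\<in>X. \<forall>y\<in>X. p x = p y \<longleftrightarrow> (x, y) \<in> ret_eq n) \<and>
    (\<forall>x\<in>X. \<forall>y\<in>X. snd ((Ret ^^ n) (X, r)) (p x, p y) = (p (s x y), p (gamma r y x)))"
proof (induction n)
  case 0
  show ?case by (intro exI[of _ id]) (auto simp: s_eq r_eq)
next
  case (Suc n)
  obtain Y t where Yt: "(Ret ^^ n) (X, r) = (Y, t)" by fastforce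
  from Suc obtain p where p: "p ` X = Y" "\<And>x y. x \<in> X \<Longrightarrow> y \<in> X \<Longrightarrow> p x = p y \<longleftrightarrow> (x, y) \<in> ret_eq n"
    "\<And>x y. x \<in> X \<Longrightarrow> y \<in> X \<Longrightarrow> t (p x, p y) = (p (s x y), p (gamma r y x))"
    by (auto simp: Yt)
  define R where "R = ret_rel (Y, t)"
  have R: "(p x, p y) \<in> R \<longleftrightarrow> (x, y) \<in> ret_eq (Suc n)" if "x \<in> X" "y \<in> X" for x y
  proof -
    have "(p x, p y) \<in> R \<longleftrightarrow> (\<forall>z\<in>X. sigma t (p x) (p z) = sigma t (p y) (p z))"
      using that p(1) by (auto simp: R_def ret_rel_def)
    also have "\<dots> \<longleftrightarrow> (\<forall>z\<in>X. p (s x z) = p (s y z))"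
      using that p(3) by (simp add: sigma_def)
    finally show ?thesis using that p(2) by simp
  qed
  have eqR: "equiv Y R" using equiv_ret_rel[of "(Y, t)"] by (simp add: R_def)
  have RY: "R \<subseteq> Y \<times> Y" using eqR by (rule equiv_type)
  let ?f = "\<lambda>A. SOME x. x \<in> A"
  obtain Z u where Zu: "quotient_sol (Y, t) = (Z, u)" by fastforce
  have Z: "Z = Y // R" using Zu by (simp add: quotient_sol_def Let_def R_def)
  have u: "u (R `` {p x}, R `` {p y}) = (R `` {p (s x y)}, R `` {p (gamma r y x)})"
    if xy: "x \<in> X" "y \<in> X" for x y
  proof -
    \<comment> \<open>All pairs of representatives give the same pair of classes, so the image in
      \<open>quotient_sol\<close> is a singleton and \<open>the_elem\<close> returns its
      element.\<close>
    have "(R `` {sigma t a b}, R `` {gamma t b a}) = (R `` {p (s x y)}, R `` {p (gamma r y x)})"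
      if "a \<in> R `` {p x}" "b \<in> R `` {p y}" for a b
    proof -
      have "a \<in> p ` X" "b \<in> p ` X" using that RY p(1) by auto
      then obtain x' y' where *: "x' \<in> X" "y' \<in> X" "a = p x'" "b = p y'" by blast
      then have E: "(x, x') \<in> ret_eq (Suc n)" "(y, y') \<in> ret_eq (Suc n)" using that R xy by auto
      have "(p (s x y), p (s x' y')) \<in> R"
        using ret_eq_s_cong[OF E] xy * by (subst R) auto
      moreover have "(p (gamma r y x), p (gamma r y' x')) \<in> R"
        using ret_eq_gamma_cong[OF E] xy * gamma_in_X by (subst R) auto
      ultimately show ?thesis
        using equiv_class_eq[OF eqR] * p(3) by (simp add: sigma_def gamma_def)
    qed
    moreover have "(p x, p x) \<in> R" "(p y, p y) \<in> R" using R xy ret_eq_refl by blast+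
    ultimately have "(\<lambda>(a, b). (R `` {sigma t a b}, R `` {gamma t b a})) ` (R `` {p x} \<times> R `` {p y}) =
        {(R `` {p (s x y)}, R `` {p (gamma r y x)})}"
      by (auto simp: image_iff)
    moreover have "u (A, B) = the_elem ((\<lambda>(a, b). (R `` {sigma t a b}, R `` {gamma t b a})) ` (A \<times> B))" for A B
      using Zu by (auto simp: quotient_sol_def Let_def R_def)
    ultimately show ?thesis by simp
  qed
  have iso: "bij_betw ?f Z (fst (Ret (Y, t)))"
    "\<And>A B. A \<in> Z \<Longrightarrow> B \<in> Z \<Longrightarrow> snd (Ret (Y, t)) (?f A, ?f B) = map_prod ?f ?f (u (A, B))"
    using Ret_iso[of "(Y, t)"] by (auto simp: Zu sol_iso_def split: prod.splits)
  \<comment> \<open>\<open>Ret\<close> stores a class through a chosen representative, so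
    \<open>p\<close> is followed by the class map and that choice.\<close>
  define p' where "p' x = ?f (R `` {p x})" for x
  have cl: "R `` {p x} \<in> Z" if "x \<in> X" for x using that p(1) Z by (auto intro: quotientI)
  have "Z = (\<lambda>x. R `` {p x}) ` X" using Z p(1) by (auto simp: quotient_def)
  then have "p' ` X = fst (Ret (Y, t))" using iso(1) by (auto simp: bij_betw_def p'_def image_image)
  moreover have "p' x = p' y \<longleftrightarrow> (x, y) \<in> ret_eq (Suc n)" if "x \<in> X" "y \<in> X" for x y
  proof -
    have "p' x = p' y \<longleftrightarrow> R `` {p x} = R `` {p y}"
      unfolding p'_def using inj_on_eq_iff[OF bij_betw_imp_inj_on[OF iso(1)]] cl that by blast
    also have "\<dots> \<longleftrightarrow> (p x, p y) \<in> R"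
      using eq_equiv_class_iff[OF eqR] that p(1) by blast
    finally show ?thesis using R that by blast
  qed
  moreover have "snd (Ret (Y, t)) (p' x, p' y) = (p' (s x y), p' (gamma r y x))"
    if "x \<in> X" "y \<in> X" for x y
    using that iso(2)[OF cl cl] u by (simp add: p'_def)
  ultimately show ?case
    by (intro exI[of _ p']) (simp add: Yt)
qed

text \<open>For empty \<open>X\<close> the right side holds while the cardinality is 0; hence the
  assumption.\<close>

lemma card_Ret_funpow_eq_1:
  assumes "X \<noteq> {}"
  shows "card (fst ((Ret ^^ n) (X, r))) = 1 \<longleftrightarrow> ret_eq n = X \<times> X"
proof -
  obtain p where p: "p ` X = fst ((Ret ^^ n) (X, r))"
    "\<And>x y. x \<in> X \<Longrightarrow> y \<in> X \<Longrightarrow> p x = p y \<longleftrightarrow> (x, y) \<in> ret_eq n"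
    using Ret_funpow[of n] by auto
  have "card (p ` X) = 1 \<longleftrightarrow> (\<forall>x\<in>X. \<forall>y\<in>X. p x = p y)"
  proof
    assume "card (p ` X) = 1"
    then obtain c where "p ` X = {c}" by (auto simp: card_1_singleton_iff)
    then have "p x = c" if "x \<in> X" for x using that by blast
    then show "\<forall>x\<in>X. \<forall>y\<in>X. p x = p y" by simp
  next
    assume "\<forall>x\<in>X. \<forall>y\<in>X. p x = p y"
    moreover obtain x where "x \<in> X" using assms by auto
    ultimately have "p ` X = {p x}" by blast
    then show "card (p ` X) = 1" by simp
  qed
  also have "\<dots> \<longleftrightarrow> ret_eq n = X \<times> X" using p(2) ret_eq_subset by blast
  finally show ?thesis by (simp add: p(1))
qed

lemma multipermutation_iff:
  assumes "X \<noteq> {}"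
  shows "multipermutation (X, r) \<longleftrightarrow> (\<exists>n. ret_eq n = X \<times> X)"
proof
  assume "multipermutation (X, r)"
  then show "\<exists>n. ret_eq n = X \<times> X"
    using card_Ret_funpow_eq_1[OF assms]
    by (auto simp: multipermutation_def multipermutation_level_def)
next
  assume "\<exists>n. ret_eq n = X \<times> X"
  then obtain n where "ret_eq n = X \<times> X" ..
  \<comment> \<open>A level is positive, whereas \<open>n\<close> may be 0 when \<open>X\<close> is
    a singleton; since the relations increase, \<open>Suc n\<close> serves as well.\<close>
  then have "ret_eq (Suc n) = X \<times> X" using ret_eq_Suc[of n] ret_eq_subset[of "Suc n"] by blast
  then have ex: "\<exists>m. 0 < m \<and> ret_eq m = X \<times> X" by blast
  have "multipermutation_level (LEAST m. 0 < m \<and> ret_eq m = X \<times> X) (X, r)"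
    unfolding multipermutation_level_def card_Ret_funpow_eq_1[OF assms]
    using LeastI_ex[OF ex] not_less_Least by blast
  then show "multipermutation (X, r)" by (auto simp: multipermutation_def)
qed

end

section \<open>The cocycle on the structure group\<close>

text \<open>The semidirect product of \<open>\<int>\<^sup>X\<close> by the symmetric group of
  \<open>X\<close> permuting coordinates.\<close>

definition vector_permutation_group :: "'a set \<Rightarrow> (('a \<Rightarrow> int) \<times> ('a \<Rightarrow> 'a)) monoid" where
  "vector_permutation_group X =
     \<lparr>carrier = {(a, p). (\<forall>y. y \<notin> X \<longrightarrow> a y = 0) \<and> p permutes X},
      monoid.mult = (\<lambda>(a, p) (b, q). (\<lambda>y. a y + b (inv_into UNIV p y), p \<circ> q)),
      one = (\<lambda>_. 0, id)\<rparr>"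

lemma group_vector_permutation_group: "group (vector_permutation_group X)"
proof (rule groupI)
  let ?W = "vector_permutation_group X"
  note W = vector_permutation_group_def
  fix g h k assume "g \<in> carrier ?W" "h \<in> carrier ?W" "k \<in> carrier ?W"
  then obtain a p b q c t where *: "g = (a, p)" "h = (b, q)" "k = (c, t)"
    "p permutes X" "q permutes X" "\<And>y. y \<notin> X \<Longrightarrow> a y = 0" "\<And>y. y \<notin> X \<Longrightarrow> b y = 0"
    by (auto simp: W)
  have inv: "inv_into UNIV (p \<circ> q) = inv_into UNIV q \<circ> inv_into UNIV p"
    using *(4,5) by (intro o_inv_distrib permutes_bij)
  have out: "inv_into UNIV p y \<notin> X" if "y \<notin> X" for y
    using that permutes_in_image[OF permutes_inv[OF *(4)]] by blast
  show "g \<otimes>\<^bsub>?W\<^esub> h \<in> carrier ?W"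
    using * out by (auto simp: W intro: permutes_compose)
  show "g \<otimes>\<^bsub>?W\<^esub> h \<otimes>\<^bsub>?W\<^esub> k = g \<otimes>\<^bsub>?W\<^esub> (h \<otimes>\<^bsub>?W\<^esub> k)"
    using * by (simp add: W inv o_assoc add.assoc)
next
  let ?W = "vector_permutation_group X"
  note W = vector_permutation_group_def
  show "\<one>\<^bsub>?W\<^esub> \<in> carrier ?W" by (simp add: W permutes_id)
  show "\<one>\<^bsub>?W\<^esub> \<otimes>\<^bsub>?W\<^esub> g = g" if "g \<in> carrier ?W" for g
    using that by (auto simp: W)
  show "\<exists>h\<in>carrier ?W. h \<otimes>\<^bsub>?W\<^esub> g = \<one>\<^bsub>?W\<^esub>" if "g \<in> carrier ?W" for g
  proof -
    obtain a p where g: "g = (a, p)" "p permutes X" "\<And>y. y \<notin> X \<Longrightarrow> a y = 0"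
      using \<open>g \<in> carrier ?W\<close> by (auto simp: W)
    have "inv_into UNIV (inv_into UNIV p) = p" using g(2) by (rule permutes_inv_inv)
    then have "(\<lambda>y. - a (p y), inv_into UNIV p) \<otimes>\<^bsub>?W\<^esub> g = \<one>\<^bsub>?W\<^esub>"
      using g(1,2) by (simp add: W permutes_inv_o)
    moreover have "(\<lambda>y. - a (p y), inv_into UNIV p) \<in> carrier ?W"
      using g by (auto simp: W permutes_inv permutes_in_image)
    ultimately show ?thesis by blast
  qed
qed

text \<open>
  The map \<open>coc\<close> is a one-cocycle of \<open>G\<close> with values in the vectors supported on \<open>X\<close>, on which
  \<open>G\<close> acts through \<open>lam\<close>.  It identifies \<open>G\<close> with the multiplicative group of a left brace whose
  additive group is free abelian on \<open>X\<close>.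
\<close>

locale structure_brace = finite_solution X r + group G
  for X :: "'a set" and r :: "'a \<times> 'a \<Rightarrow> 'a \<times> 'a" and G :: "('g, 'm) monoid_scheme" (structure) +
  fixes gen :: "'a \<Rightarrow> 'g" and lam :: "'g \<Rightarrow> 'a \<Rightarrow> 'a" and coc :: "'g \<Rightarrow> 'a \<Rightarrow> int"
  assumes gen_closed [simp]: "x \<in> X \<Longrightarrow> gen x \<in> carrier G"
    and generate_gen: "generate G (gen ` X) = carrier G"
    and gen_rel: "x \<in> X \<Longrightarrow> y \<in> X \<Longrightarrow> gen x \<otimes> gen y = gen (s x y) \<otimes> gen (gamma r y x)"
    and lam_permutes: "g \<in> carrier G \<Longrightarrow> lam g permutes X"
    and lam_mult: "g \<in> carrier G \<Longrightarrow> h \<in> carrier G \<Longrightarrow> lam (g \<otimes> h) = lam g \<circ> lam h"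
    and lam_gen: "x \<in> X \<Longrightarrow> lam (gen x) = s x"
    and coc_outside: "g \<in> carrier G \<Longrightarrow> y \<notin> X \<Longrightarrow> coc g y = 0"
    and coc_mult: "g \<in> carrier G \<Longrightarrow> h \<in> carrier G \<Longrightarrow>
      coc (g \<otimes> h) (lam g y) = coc g (lam g y) + coc h y"
    and coc_gen: "x \<in> X \<Longrightarrow> coc (gen x) = unit_vec x"

text \<open>The universal property extends \<open>x \<mapsto> (unit_vec x, s x)\<close> to the
  structure group; \<open>coc\<close> and \<open>lam\<close> are the two components of this
  homomorphism.\<close>

lemma (in finite_solution) structure_brace_structure_group:
  "\<exists>gen lam coc. structure_brace X r (structure_group (X, r)) gen lam coc"
proof -
  let ?R = "{([(x, True), (y, True)], [(u, True), (v, True)]) | x y u v.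
        x \<in> X \<and> y \<in> X \<and> u \<in> X \<and> v \<in> X \<and> r (x, y) = (u, v)}"
  let ?G = "presented_group X ?R" and ?W = "vector_permutation_group X"
  let ?c = "\<lambda>w. pres_cong X ?R `` {w}"
  let ?f = "\<lambda>x. (unit_vec x, s x)"
  note W = vector_permutation_group_def
  interpret W: group ?W by (rule group_vector_permutation_group)
  interpret G: group ?G by (rule group_presented_group)
  have f: "?f \<in> X \<rightarrow> carrier ?W" by (auto simp: W s_permutes unit_vec_def)
  have "word_eval ?W ?f p = word_eval ?W ?f q" if pq: "(p, q) \<in> ?R" for p q
  proof -
    obtain x y where xy: "x \<in> X" "y \<in> X" "p = [(x, True), (y, True)]"
      "q = [(s x y, True), (gamma r y x, True)]"
      using pq by (auto simp: r_eq s_eq)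
    have ev: "word_eval ?W ?f [(x, True), (y, True)] = ?f x \<otimes>\<^bsub>?W\<^esub> ?f y" if "x \<in> X" "y \<in> X" for x y
      using f that by (simp add: word_eval_def Pi_iff)
    have prod: "?f x \<otimes>\<^bsub>?W\<^esub> ?f y = (\<lambda>z. unit_vec x z + unit_vec (s x y) z, s x \<circ> s y)"
      for x y
    proof -
      have "cdot x z = y \<longleftrightarrow> z = s x y" for z by auto
      then show ?thesis by (simp add: W unit_vec_def flip: cdot_def)
    qed
    \<comment> \<open>By \<open>s_gamma\<close> both words have as vector part the sum of the unit
      vectors at \<open>x\<close> and \<open>s x y\<close>; the permutation parts agree by
      \<open>s_mult\<close>.\<close>
    show ?thesis
      using xy s_mult[OF xy(1,2)] s_gamma[OF xy(1,2)]
      by (simp add: ev gamma_in_X prod add.commute)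
  qed
  from presented_group_universal[OF W.is_group f this] obtain h
    where h: "h \<in> hom ?G ?W" "\<And>x. x \<in> X \<Longrightarrow> h (?c [(x, True)]) = ?f x" by blast
  have carr: "carrier ?G = ?c ` group_words X" by (auto simp: presented_group_def quotient_def)
  have mult: "?c u \<otimes>\<^bsub>?G\<^esub> ?c v = ?c (u @ v)" if "u \<in> group_words X" "v \<in> group_words X" for u v
    using that by (rule presented_group_mult)
  have one: "\<one>\<^bsub>?G\<^esub> = ?c []" by (simp add: presented_group_def)
  have hW: "h g \<in> carrier ?W" if "g \<in> carrier ?G" for g using h(1) that by (rule hom_in_carrier)
  have hm: "h (g \<otimes>\<^bsub>?G\<^esub> k) = h g \<otimes>\<^bsub>?W\<^esub> h k" if "g \<in> carrier ?G" "k \<in> carrier ?G" for g k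
    using h(1) that by (rule hom_mult)
  let ?gen = "\<lambda>x. ?c [(x, True)]"
  have gen: "?gen x \<in> carrier ?G" if "x \<in> X" for x using that by (simp add: carr)
  have inv: "inv\<^bsub>?G\<^esub> (?gen x) = ?c [(x, False)]" if "x \<in> X" for x
  proof (rule G.inv_equality)
    have "([] @ [(x, False), (x, \<not> False)] @ [], [] @ []) \<in> pres_cong X ?R"
      using that by (intro pres_cong.cancel) auto
    then have "?c [(x, False), (x, True)] = ?c []"
      using equiv_class_eq[OF equiv_pres_cong] by fastforce
    then show "?c [(x, False)] \<otimes>\<^bsub>?G\<^esub> ?gen x = \<one>\<^bsub>?G\<^esub>"
      using that by (simp add: mult one)
  qed (use that in \<open>simp_all add: carr\<close>)
  have gens: "?c w \<in> generate ?G (?gen ` X)" if "w \<in> group_words X" for w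
    using that
  proof (induction w)
    case Nil
    show ?case using generate.one[of ?G] by (simp add: one)
  next
    case (Cons a w)
    obtain x b where a: "a = (x, b)" by fastforce
    have x: "x \<in> X" "w \<in> group_words X" using Cons.prems a by auto
    have "?c [a] \<in> generate ?G (?gen ` X)"
      using x generate.incl[of "?gen x" "?gen ` X" ?G] generate.inv[of "?gen x" "?gen ` X" ?G]
      by (cases b) (auto simp: a inv)
    then have "?c [a] \<otimes>\<^bsub>?G\<^esub> ?c w \<in> generate ?G (?gen ` X)"
      using Cons.IH x by (intro generate.eng) auto
    then show ?case using x a mult[of "[a]" w] by simp
  qed
  have "structure_brace X r ?G ?gen (\<lambda>g. snd (h g)) (\<lambda>g. fst (h g))"
  proof (intro structure_brace.intro structure_brace_axioms.intro)
    show "finite_solution X r" by (rule finite_solution_axioms)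
    show "group ?G" by (rule G.is_group)
    show "?gen x \<in> carrier ?G" if "x \<in> X" for x using that by (rule gen)
    show "generate ?G (?gen ` X) = carrier ?G"
    proof (rule subset_antisym)
      show "generate ?G (?gen ` X) \<subseteq> carrier ?G"
        using gen by (intro G.generate_incl image_subsetI)
      show "carrier ?G \<subseteq> generate ?G (?gen ` X)" unfolding carr using gens by blast
    qed
    show "?gen x \<otimes>\<^bsub>?G\<^esub> ?gen y = ?gen (s x y) \<otimes>\<^bsub>?G\<^esub> ?gen (gamma r y x)"
      if xy: "x \<in> X" "y \<in> X" for x y
    proof -
      have sX: "s x y \<in> X" "gamma r y x \<in> X" using xy gamma_in_X by auto
      have "([(x, True), (y, True)], [(s x y, True), (gamma r y x, True)]) \<in> ?R"
        using xy sX by (auto simp: r_eq s_eq)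
      then have "([] @ [(x, True), (y, True)] @ [], [] @ [(s x y, True), (gamma r y x, True)] @ [])
          \<in> pres_cong X ?R"
        using xy sX by (intro pres_cong.rel) auto
      then have "?c [(x, True), (y, True)] = ?c [(s x y, True), (gamma r y x, True)]"
        using equiv_class_eq[OF equiv_pres_cong] by fastforce
      then show ?thesis using xy sX by (simp add: mult)
    qed
    show "snd (h g) permutes X" if "g \<in> carrier ?G" for g using hW[OF that] by (auto simp: W)
    show "snd (h (g \<otimes>\<^bsub>?G\<^esub> k)) = snd (h g) \<circ> snd (h k)" if "g \<in> carrier ?G" "k \<in> carrier ?G" for g k
      using that by (simp add: hm) (simp add: W split: prod.splits)
    show "snd (h (?gen x)) = s x" "fst (h (?gen x)) = unit_vec x" if "x \<in> X" for x
      using that by (simp_all add: h(2))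
    show "fst (h g) y = 0" if "g \<in> carrier ?G" "y \<notin> X" for g y
      using hW[OF that(1)] that(2) by (auto simp: W)
    show "fst (h (g \<otimes>\<^bsub>?G\<^esub> k)) (snd (h g) y) = fst (h g) (snd (h g) y) + fst (h k) y"
      if gk: "g \<in> carrier ?G" "k \<in> carrier ?G" for g k y
    proof -
      obtain a p where ap: "h g = (a, p)" "p permutes X" using hW[OF gk(1)] by (auto simp: W)
      then show ?thesis using gk permutes_inverses(2)[OF ap(2)]
        by (simp add: hm) (simp add: W split: prod.splits)
    qed
  qed
  then show ?thesis by (auto simp: structure_group_def)
qed

context structure_brace
begin

lemma lam_in_X [simp]: "g \<in> carrier G \<Longrightarrow> lam g x \<in> X \<longleftrightarrow> x \<in> X"
  using lam_permutes by (rule permutes_in_image)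

lemma lam_one [simp]: "lam \<one> = id"
proof
  fix x
  have "lam \<one> (lam \<one> x) = lam \<one> x" using lam_mult[of \<one> \<one>] by (metis comp_apply l_one one_closed)
  then show "lam \<one> x = id x" using permutes_inj[OF lam_permutes[of \<one>]] by (simp add: inj_eq)
qed

lemma lam_inv [simp]:
  assumes "g \<in> carrier G"
  shows "lam (inv g) (lam g x) = x" "lam g (lam (inv g) x) = x"
proof -
  have "lam (inv g) \<circ> lam g = id" "lam g \<circ> lam (inv g) = id"
    using lam_mult[of "inv g" g] lam_mult[of g "inv g"] assms by auto
  then show "lam (inv g) (lam g x) = x" "lam g (lam (inv g) x) = x"
    by (metis comp_apply id_apply)+
qed

lemma coc_one: "coc \<one> = (\<lambda>_. 0)"
  using coc_mult[of \<one> \<one>] by auto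

lemma coc_mult':
  assumes "g \<in> carrier G" "h \<in> carrier G"
  shows "coc (g \<otimes> h) y = coc g y + coc h (lam (inv g) y)"
  using coc_mult[OF assms, of "lam (inv g) y"] assms by simp

lemma lam_inv_gen: "x \<in> X \<Longrightarrow> lam (inv (gen x)) = cdot x"
proof
  fix y assume "x \<in> X"
  then show "lam (inv (gen x)) y = cdot x y"
    using lam_inv(1)[of "gen x" "cdot x y"] by (simp add: lam_gen)
qed

lemma gen_cdot_commute:
  assumes "x \<in> X" "y \<in> X"
  shows "gen x \<otimes> gen (cdot x y) = gen y \<otimes> gen (cdot y x)"
  using gen_rel[of x "cdot x y"] gamma_eq[of x "cdot x y"] assms by simp

lemma gen_induct [consumes 1, case_names one gen inv]:
  assumes g: "g \<in> carrier G"
    and "P \<one>"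
    and gen: "\<And>g x. g \<in> carrier G \<Longrightarrow> x \<in> X \<Longrightarrow> P g \<Longrightarrow> P (g \<otimes> gen x)"
    and inv: "\<And>g x. g \<in> carrier G \<Longrightarrow> x \<in> X \<Longrightarrow> P g \<Longrightarrow> P (g \<otimes> inv (gen x))"
  shows "P g"
proof -
  \<comment> \<open>Quantifying over a left factor \<open>h\<close> makes the claim compose along
    the products that \<open>generate\<close> builds.\<close>
  have "\<forall>h\<in>carrier G. P h \<longrightarrow> P (h \<otimes> g)" if "g \<in> generate G (gen ` X)" for g
    using that
  proof (induction rule: generate.induct)
    case (eng h1 h2)
    then have "h1 \<in> carrier G" "h2 \<in> carrier G" using generate_gen by auto
    then show ?case using eng.IH by (simp add: m_assoc[symmetric])
  qed (use gen inv in auto)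
  then show ?thesis using g generate_gen \<open>P \<one>\<close> by (metis l_one one_closed)
qed

section \<open>Bijectivity of the cocycle\<close>

text \<open>
  This is \<open>g \<mapsto> g + x\<close> in the left brace.  The bijections \<open>add_gen x\<close> commute, so
  \<open>\<int>\<^sup>X\<close> acts on \<open>G\<close>, and moving \<open>\<one>\<close> by \<open>coc g\<close> recovers \<open>g\<close>.
\<close>

definition add_gen :: "'a \<Rightarrow> 'g \<Rightarrow> 'g" where
  "add_gen x g = (if g \<in> carrier G then g \<otimes> gen (lam (inv g) x) else g)"

lemma add_gen_closed: "x \<in> X \<Longrightarrow> add_gen x g \<in> carrier G \<longleftrightarrow> g \<in> carrier G"
  by (simp add: add_gen_def)

lemma coc_add_gen:
  assumes "x \<in> X" "g \<in> carrier G"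
  shows "coc (add_gen x g) = (\<lambda>y. coc g y + unit_vec x y)"
proof
  fix y
  have "lam (inv g) y = lam (inv g) x \<longleftrightarrow> y = x" using assms lam_inv(2) by metis
  then show "coc (add_gen x g) y = coc g y + unit_vec x y"
    using assms by (simp add: add_gen_def coc_mult' coc_gen unit_vec_def)
qed

lemma mult_gen_eq_add_gen: "x \<in> X \<Longrightarrow> g \<in> carrier G \<Longrightarrow> g \<otimes> gen x = add_gen (lam g x) g"
  by (simp add: add_gen_def)

text \<open>Each composite multiplies \<open>g\<close> by one side of
  \<open>gen_cdot_commute\<close>, taken at the points \<open>lam (inv g) x\<close> and
  \<open>lam (inv g) y\<close>.\<close>

lemma add_gen_commute:
  assumes "x \<in> X" "y \<in> X"
  shows "add_gen x \<circ> add_gen y = add_gen y \<circ> add_gen x"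
proof
  have *: "add_gen v (add_gen u g) = g \<otimes> (gen (lam (inv g) u) \<otimes> gen (cdot (lam (inv g) u) (lam (inv g) v)))"
    if "g \<in> carrier G" "u \<in> X" "v \<in> X" for g u v
    using that by (simp add: add_gen_def inv_mult_group lam_mult lam_inv_gen m_assoc)
  fix g
  show "(add_gen x \<circ> add_gen y) g = (add_gen y \<circ> add_gen x) g"
  proof (cases "g \<in> carrier G")
    case True
    then show ?thesis using assms gen_cdot_commute[of "lam (inv g) x" "lam (inv g) y"]
      by (simp add: *)
  qed (simp add: add_gen_def)
qed

text \<open>With u = \<open>lam (inv g) x\<close>, the inverse of \<open>add_gen x g\<close> sends
  \<open>x\<close> to \<open>cdot u u\<close>. This determines u, and then g. For surjectivity, the
  injective map z to \<open>cdot z z\<close> is onto the finite set \<open>X\<close>.\<close>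

lemma bij_add_gen:
  assumes x: "x \<in> X"
  shows "bij (add_gen x)"
proof (rule bijI)
  have lam: "lam (inv (add_gen x g)) x = cdot (lam (inv g) x) (lam (inv g) x)" if "g \<in> carrier G" for g
    using that x by (simp add: add_gen_def inv_mult_group lam_mult lam_inv_gen)
  show "inj (add_gen x)"
  proof (rule injI)
    fix g h assume eq: "add_gen x g = add_gen x h"
    show "g = h"
    proof (cases "g \<in> carrier G")
      case True
      then have h: "h \<in> carrier G" using eq add_gen_closed[OF x] by metis
      have "lam (inv g) x = lam (inv h) x"
        using lam[OF True] lam[OF h] eq True h x inj_onD[OF cdot_self_inj] by (metis lam_in_X inv_closed)
      then show ?thesis using eq True h x by (simp add: add_gen_def)
    next
      case False
      then have h: "h \<notin> carrier G" using eq add_gen_closed[OF x] by metis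
      then show ?thesis using eq False by (simp add: add_gen_def)
    qed
  qed
  show "surj (add_gen x)"
  proof -
    have "\<exists>g. k = add_gen x g" for k
    proof (cases "k \<in> carrier G")
      case True
      have "(\<lambda>z. cdot z z) ` X = X"
        using finite by (intro endo_inj_surj cdot_self_inj) auto
      then have "lam (inv k) x \<in> (\<lambda>z. cdot z z) ` X" using x True by simp
      then obtain z where z: "z \<in> X" "lam (inv k) x = cdot z z" by blast
      have "lam (inv (k \<otimes> inv (gen z))) x = z"
        using z True by (simp add: inv_mult_group lam_mult lam_gen)
      then have "add_gen x (k \<otimes> inv (gen z)) = k"
        using z True by (simp add: add_gen_def m_assoc)
      then show ?thesis by metis
    qed (auto simp: add_gen_def)
    then show ?thesis by (simp add: surj_def)
  qed
qed

text \<open>Letting vectors act on \<open>\<one>\<close> through \<open>add_gen\<close> gives a left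
  inverse of \<open>coc\<close>. Right multiplication by a generator is one translation; for the
  inverse of a generator a translation is cancelled.\<close>

lemma coc_inj: "inj_on coc (carrier G)"
proof -
  obtain act :: "('a \<Rightarrow> int) \<Rightarrow> 'g \<Rightarrow> 'g" where act: "act (\<lambda>_. 0) = id"
    "\<And>a x. x \<in> X \<Longrightarrow> act (\<lambda>z. a z + unit_vec x z) = add_gen x \<circ> act a"
    using commuting_bijections_action[OF finite, of add_gen] bij_add_gen add_gen_commute by blast
  have "act (coc g) \<one> = g" if "g \<in> carrier G" for g
    using that
  proof (induction rule: gen_induct)
    case one
    then show ?case by (simp add: coc_one act(1))
  next
    case (gen g x)
    then show ?case by (simp add: mult_gen_eq_add_gen coc_add_gen act(2))
  next
    case (inv g x)
    define h where "h = g \<otimes> inv (gen x)"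
    have h: "h \<in> carrier G" and g: "g = add_gen (lam h x) h"
      using inv mult_gen_eq_add_gen[of x h] by (auto simp: h_def m_assoc)
    have "coc g = (\<lambda>y. coc h y + unit_vec (lam h x) y)"
      using coc_add_gen[of "lam h x" h] h g inv.hyps by simp
    then have "add_gen (lam h x) (act (coc h) \<one>) = g"
      using inv.IH h inv.hyps by (simp add: act(2))
    then have "add_gen (lam h x) (act (coc h) \<one>) = add_gen (lam h x) h"
      using g by simp
    then show ?case
      using bij_is_inj[OF bij_add_gen[of "lam h x"]] h inv.hyps by (simp add: inj_eq h_def)
  qed
  then show ?thesis by (intro inj_on_inverseI)
qed

text \<open>As \<open>add_gen x\<close> is bijective, unit vectors can be subtracted as well as
  added; the coordinates are adjusted one at a time.\<close>

lemma coc_surj: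
  assumes "\<And>y. y \<notin> X \<Longrightarrow> a y = 0"
  shows "\<exists>g\<in>carrier G. coc g = a"
proof -
  have add: "\<exists>g\<in>carrier G. coc g = (\<lambda>y. a y + k * unit_vec x y)"
    if x: "x \<in> X" and a: "\<exists>g\<in>carrier G. coc g = a" for a k x
  proof (induction k rule: int_induct[where k = 0])
    case base
    then show ?case using a by simp
  next
    case (step1 k)
    then obtain g where "g \<in> carrier G" "coc g = (\<lambda>y. a y + k * unit_vec x y)" by blast
    then show ?case using x
      by (intro bexI[of _ "add_gen x g"]) (auto simp: coc_add_gen add_gen_closed algebra_simps)
  next
    case (step2 k)
    then obtain g where g: "g \<in> carrier G" "coc g = (\<lambda>y. a y + k * unit_vec x y)" by blast
    obtain h where h: "g = add_gen x h" using bij_is_surj[OF bij_add_gen[OF x]] by (metis surjD)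
    then have hc: "h \<in> carrier G" using g add_gen_closed[OF x] by blast
    then have "coc h y + unit_vec x y = a y + k * unit_vec x y" for y
      using g h coc_add_gen[OF x hc] by metis
    then have "coc h y = a y + (k - 1) * unit_vec x y" for y
      by (simp add: algebra_simps eq_diff_eq)
    then show ?case using hc by (intro bexI[of _ h]) auto
  qed
  have "\<exists>g\<in>carrier G. coc g = a" if "\<And>y. y \<notin> A \<Longrightarrow> a y = 0" "A \<subseteq> X" "finite A" for A a
    using that(3,1,2)
  proof (induction A arbitrary: a rule: finite_induct)
    case empty
    then have "a = (\<lambda>_. 0)" by auto
    then show ?case using coc_one by blast
  next
    case (insert x A)
    have ex: "\<exists>g\<in>carrier G. coc g = a(x := 0)" using insert.prems by (intro insert.IH) auto
    have "\<exists>g\<in>carrier G. coc g = (\<lambda>y. (a(x := 0)) y + a x * unit_vec x y)"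
      using insert.prems by (intro add[OF _ ex]) simp
    moreover have "(\<lambda>y. (a(x := 0)) y + a x * unit_vec x y) = a" by (auto simp: unit_vec_def)
    ultimately show ?case by (simp only:)
  qed
  then show ?thesis using assms finite by blast
qed

end

section \<open>Zero sum ideals\<close>

context structure_brace
begin

text \<open>
  When \<open>zero_sum E\<close> is contained in \<open>stab E\<close> it is an ideal of the left brace; the additive group
  of the quotient is free abelian on \<open>X/E\<close>.
\<close>

definition zero_sum :: "('a \<times> 'a) set \<Rightarrow> 'g set" where
  "zero_sum E = {g \<in> carrier G. \<forall>x\<in>X. (\<Sum>y\<in>E `` {x}. coc g y) = 0}"

lemma zero_sum_mono:
  assumes "equiv X E" "equiv X F" "F \<subseteq> E"
  shows "zero_sum F \<subseteq> zero_sum E"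
proof
  fix g assume g: "g \<in> zero_sum F"
  have "(\<Sum>y\<in>E `` {x}. coc g y) = 0" if "x \<in> X" for x
    using finite assms _ that by (rule zero_class_sums_coarser) (use g in \<open>simp add: zero_sum_def\<close>)
  then show "g \<in> zero_sum E" using g by (simp add: zero_sum_def)
qed

text \<open>For an invariant equivalence \<open>E\<close> this is the kernel of the action on the
  classes of \<open>E\<close>.\<close>

definition stab :: "('a \<times> 'a) set \<Rightarrow> 'g set" where
  "stab E = {g \<in> carrier G. \<forall>x\<in>X. (x, lam g x) \<in> E}"

definition orbit_rel :: "('a \<times> 'a) set \<Rightarrow> ('a \<times> 'a) set" where
  "orbit_rel E = {(x, lam g x) | x g. x \<in> X \<and> g \<in> zero_sum E}"

definition invariant_equiv :: "('a \<times> 'a) set \<Rightarrow> bool" where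
  "invariant_equiv E \<longleftrightarrow> equiv X E \<and>
    (\<forall>g\<in>carrier G. \<forall>x y. (x, y) \<in> E \<longrightarrow> (lam g x, lam g y) \<in> E)"

lemma invariant_equivD:
  assumes "invariant_equiv E"
  shows "equiv X E" "E \<subseteq> X \<times> X" "\<And>x. x \<in> X \<Longrightarrow> (x, x) \<in> E" "\<And>x y. (x, y) \<in> E \<Longrightarrow> (y, x) \<in> E"
    "\<And>x y z. (x, y) \<in> E \<Longrightarrow> (y, z) \<in> E \<Longrightarrow> (x, z) \<in> E"
    "\<And>g x y. g \<in> carrier G \<Longrightarrow> (x, y) \<in> E \<Longrightarrow> (lam g x, lam g y) \<in> E"
    "\<And>x. finite (E `` {x})"
proof -
  show E: "equiv X E" using assms by (simp add: invariant_equiv_def)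
  then show EX: "E \<subseteq> X \<times> X" by (rule equiv_type)
  show "(x, x) \<in> E" if "x \<in> X" for x using equiv_class_self[OF E that] by simp
  show "(y, x) \<in> E" if "(x, y) \<in> E" for x y using E that by (auto elim!: equivE dest: symD)
  show "(x, z) \<in> E" if "(x, y) \<in> E" "(y, z) \<in> E" for x y z
    using E that by (auto elim!: equivE dest: transD)
  show "(lam g x, lam g y) \<in> E" if "g \<in> carrier G" "(x, y) \<in> E" for g x y
    using assms that by (simp add: invariant_equiv_def)
  show "finite (E `` {x})" for x using EX by (auto intro: finite_subset[OF _ finite])
qed

lemma subgroup_stab:
  assumes "invariant_equiv E"
  shows "subgroup (stab E) G"
proof (rule subgroupI)
  note E = invariant_equivD[OF assms]
  show "stab E \<subseteq> carrier G" by (auto simp: stab_def)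
  show "stab E \<noteq> {}" using E(3) by (auto simp: stab_def intro!: exI[of _ \<one>])
  show "inv g \<in> stab E" if "g \<in> stab E" for g
  proof -
    have g: "g \<in> carrier G" using that by (simp add: stab_def)
    have "(x, lam (inv g) x) \<in> E" if x: "x \<in> X" for x
    proof -
      have "(lam (inv g) x, lam g (lam (inv g) x)) \<in> E"
        using \<open>g \<in> stab E\<close> x g by (simp add: stab_def del: lam_inv)
      then show ?thesis using g E(4) by simp
    qed
    then show ?thesis using g by (simp add: stab_def)
  qed
  show "g \<otimes> h \<in> stab E" if "g \<in> stab E" "h \<in> stab E" for g h
  proof -
    have "(x, lam g (lam h x)) \<in> E" if "x \<in> X" for x
    proof (rule E(5))
      show "(x, lam h x) \<in> E" "(lam h x, lam g (lam h x)) \<in> E"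
        using that \<open>g \<in> stab E\<close> \<open>h \<in> stab E\<close> by (simp_all add: stab_def)
    qed
    then show ?thesis using that by (simp add: stab_def lam_mult)
  qed
qed

text \<open>\<open>lam g\<close> maps the class of \<open>x\<close> bijectively onto the class of
  \<open>lam g x\<close>.\<close>

lemma class_sum_lam:
  assumes E: "invariant_equiv E" and g: "g \<in> carrier G" and x: "x \<in> X"
  shows "(\<Sum>y\<in>E `` {lam g x}. f (lam (inv g) y)) = (\<Sum>y\<in>E `` {x}. f y)"
proof (rule sum.reindex_bij_witness[where i = "lam g" and j = "lam (inv g)"])
  note E = invariant_equivD[OF E]
  show "lam (inv g) y \<in> E `` {x}" if "y \<in> E `` {lam g x}" for y
    using E(6)[of "inv g" "lam g x" y] that g by simp
  show "lam g y \<in> E `` {lam g x}" if "y \<in> E `` {x}" for y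
    using E(6)[OF g, of x y] that by simp
qed (use g in auto)

lemma class_stab:
  assumes E: "invariant_equiv E" and "g \<in> stab E" "x \<in> X"
  shows "E `` {lam g x} = E `` {x}"
  using equiv_class_eq[OF invariant_equivD(1)[OF E]] assms by (auto simp: stab_def)

text \<open>An element of \<open>stab E\<close> permutes each class, so the twist in the cocycle
  identity disappears on summation. Class sums thus become homomorphisms on subgroups of
  \<open>stab E\<close>.\<close>

lemma class_sum_mult:
  assumes E: "invariant_equiv E" and g: "g \<in> stab E" and h: "h \<in> carrier G" and x: "x \<in> X"
  shows "(\<Sum>y\<in>E `` {x}. coc (g \<otimes> h) y) = (\<Sum>y\<in>E `` {x}. coc g y) + (\<Sum>y\<in>E `` {x}. coc h y)"
proof -
  have gc: "g \<in> carrier G" using g by (simp add: stab_def)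
  have "(\<Sum>y\<in>E `` {x}. coc h (lam (inv g) y)) = (\<Sum>y\<in>E `` {x}. coc h y)"
    using class_sum_lam[OF E gc x, of "coc h"] class_stab[OF E g x] by simp
  then show ?thesis using gc h by (simp add: coc_mult' sum.distrib)
qed

lemma subgroup_zero_sum:
  assumes E: "invariant_equiv E" and sub: "zero_sum E \<subseteq> stab E"
  shows "subgroup (zero_sum E) G"
proof (rule subgroupI)
  show "zero_sum E \<subseteq> carrier G" by (auto simp: zero_sum_def)
  show "zero_sum E \<noteq> {}" by (auto simp: zero_sum_def coc_one intro!: exI[of _ \<one>])
  show "inv g \<in> zero_sum E" if g: "g \<in> zero_sum E" for g
  proof -
    have gc: "g \<in> carrier G" using g by (simp add: zero_sum_def)
    have "(\<Sum>y\<in>E `` {x}. coc (inv g) y) = 0" if "x \<in> X" for x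
      using class_sum_mult[OF E, of g "inv g" x] g gc sub that by (auto simp: coc_one zero_sum_def)
    then show ?thesis using gc by (simp add: zero_sum_def)
  qed
  show "g \<otimes> h \<in> zero_sum E" if "g \<in> zero_sum E" "h \<in> zero_sum E" for g h
    using class_sum_mult[OF E, of g h] that sub by (auto simp: zero_sum_def)
qed

text \<open>Compares class sums in (k h k^-1) k = k h. On the left they add up because the conjugate
  fixes every class; on the right \<open>h\<close> contributes its sum over a translated class,
  which is zero.\<close>

lemma zero_sum_conj:
  assumes E: "invariant_equiv E" and sub: "zero_sum E \<subseteq> stab E"
    and h: "h \<in> zero_sum E" and k: "k \<in> carrier G"
  shows "k \<otimes> h \<otimes> inv k \<in> zero_sum E"
proof -
  let ?h = "k \<otimes> h \<otimes> inv k"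
  have hc: "h \<in> carrier G" using h by (simp add: zero_sum_def)
  have lam: "lam ?h x = lam k (lam h (lam (inv k) x))" for x using hc k by (simp add: lam_mult)
  have st: "?h \<in> stab E"
  proof -
    have "(x, lam ?h x) \<in> E" if x: "x \<in> X" for x
    proof -
      have "(lam (inv k) x, lam h (lam (inv k) x)) \<in> E"
        using h sub x k by (auto simp: stab_def)
      then show ?thesis using invariant_equivD(6)[OF E k] k by (fastforce simp: lam)
    qed
    then show ?thesis using hc k by (simp add: stab_def)
  qed
  have "(\<Sum>y\<in>E `` {x}. coc ?h y) = 0" if x: "x \<in> X" for x
  proof -
    have "(\<Sum>y\<in>E `` {x}. coc ?h y) + (\<Sum>y\<in>E `` {x}. coc k y) = (\<Sum>y\<in>E `` {x}. coc (?h \<otimes> k) y)"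
      using class_sum_mult[OF E st k x] by simp
    also have "?h \<otimes> k = k \<otimes> h" using hc k by (simp add: m_assoc)
    also have "(\<Sum>y\<in>E `` {x}. coc (k \<otimes> h) y) =
        (\<Sum>y\<in>E `` {x}. coc k y) + (\<Sum>y\<in>E `` {x}. coc h (lam (inv k) y))"
      using hc k by (simp add: coc_mult' sum.distrib)
    also have "(\<Sum>y\<in>E `` {x}. coc h (lam (inv k) y)) = 0"
      using class_sum_lam[OF E k, of "lam (inv k) x" "coc h"] h k x by (simp add: zero_sum_def)
    finally show ?thesis by simp
  qed
  then show ?thesis using hc k by (simp add: zero_sum_def)
qed

text \<open>\<open>G\<close> permutes the orbits of \<open>zero_sum E\<close> because that subgroup
  is normal. As \<open>zero_sum\<close> is monotone, elements of
  \<open>zero_sum (orbit_rel E)\<close> lie in \<open>zero_sum E\<close> and so move points only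
  within its orbits.\<close>

lemma orbit_rel:
  assumes E: "invariant_equiv E" and sub: "zero_sum E \<subseteq> stab E"
  shows "invariant_equiv (orbit_rel E)" "orbit_rel E \<subseteq> E"
    "zero_sum (orbit_rel E) \<subseteq> stab (orbit_rel E)"
proof -
  interpret Z: subgroup "zero_sum E" G using assms by (rule subgroup_zero_sum)
  have memI: "(x, lam g x) \<in> orbit_rel E" if "x \<in> X" "g \<in> zero_sum E" for x g
    using that by (auto simp: orbit_rel_def)
  have "equiv X (orbit_rel E)"
  proof (rule equivI)
    show "orbit_rel E \<subseteq> X \<times> X" by (auto simp: orbit_rel_def)
    show "refl_on X (orbit_rel E)"
      using memI[OF _ Z.one_closed] by (auto simp: refl_on_def orbit_rel_def)
    show "sym (orbit_rel E)"
    proof (rule symI)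
      fix x y assume "(x, y) \<in> orbit_rel E"
      then obtain g where g: "x \<in> X" "g \<in> zero_sum E" "y = lam g x" by (auto simp: orbit_rel_def)
      then show "(y, x) \<in> orbit_rel E" using memI[of y "inv g"] by simp
    qed
    show "trans (orbit_rel E)"
    proof (rule transI)
      fix x y z assume "(x, y) \<in> orbit_rel E" "(y, z) \<in> orbit_rel E"
      then obtain g h where "x \<in> X" "g \<in> zero_sum E" "y = lam g x" "h \<in> zero_sum E" "z = lam h y"
        by (auto simp: orbit_rel_def)
      then show "(x, z) \<in> orbit_rel E" using memI[of x "h \<otimes> g"] by (simp add: lam_mult)
    qed
  qed
  moreover have "(lam k x, lam k y) \<in> orbit_rel E"
    if k: "k \<in> carrier G" and xy: "(x, y) \<in> orbit_rel E" for k x y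
  proof -
    obtain g where g: "x \<in> X" "g \<in> zero_sum E" "y = lam g x" using xy by (auto simp: orbit_rel_def)
    then show ?thesis
      using memI[of "lam k x" "k \<otimes> g \<otimes> inv k"] zero_sum_conj[OF assms g(2) k] k
      by (simp add: lam_mult)
  qed
  ultimately show inv: "invariant_equiv (orbit_rel E)" by (simp add: invariant_equiv_def)
  show sub': "orbit_rel E \<subseteq> E" using sub by (auto simp: orbit_rel_def stab_def)
  have "zero_sum (orbit_rel E) \<subseteq> zero_sum E"
    using invariant_equivD(1)[OF E] invariant_equivD(1)[OF inv] sub' by (rule zero_sum_mono)
  then show "zero_sum (orbit_rel E) \<subseteq> stab (orbit_rel E)"
    using memI by (auto simp: stab_def)
qed

text \<open>\<open>gen x\<close> and \<open>gen y\<close> have equal class sums, so h = (gen y)^-1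
  gen x lies in \<open>zero_sum E\<close>. Applying \<open>gen y\<close> to the related points
  \<open>z\<close> and \<open>lam h z\<close> gives \<open>s y z\<close> and
  \<open>s x z\<close>.\<close>

lemma s_orbit_rel:
  assumes E: "invariant_equiv E" and sub: "zero_sum E \<subseteq> stab E" and xy: "(x, y) \<in> E" and z: "z \<in> X"
  shows "(s x z, s y z) \<in> orbit_rel E"
proof -
  have X: "x \<in> X" "y \<in> X" using xy invariant_equivD(2)[OF E] by auto
  define h where "h = inv (gen y) \<otimes> gen x"
  have h: "h \<in> carrier G" "gen y \<otimes> h = gen x" using X by (simp_all add: h_def)
  have "(\<Sum>w\<in>E `` {v}. coc h w) = 0" if v: "v \<in> X" for v
  proof -
    let ?C = "E `` {lam (gen y) v}"
    have "x \<in> ?C \<longleftrightarrow> y \<in> ?C" using xy invariant_equivD(4,5)[OF E] by blast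
    then have "(\<Sum>w\<in>?C. coc (gen x) w) = (\<Sum>w\<in>?C. coc (gen y) w)"
      using X invariant_equivD(7)[OF E] by (simp add: coc_gen sum_unit_vec)
    also have "(\<Sum>w\<in>?C. coc (gen x) w) = (\<Sum>w\<in>?C. coc (gen y) w) + (\<Sum>w\<in>?C. coc h (lam (inv (gen y)) w))"
      using X h coc_mult'[of "gen y" h] by (simp add: sum.distrib)
    finally show ?thesis using class_sum_lam[OF E gen_closed[OF X(2)] v, of "coc h"] by simp
  qed
  then have "(z, lam h z) \<in> orbit_rel E" using h z by (auto simp: orbit_rel_def zero_sum_def)
  then have "(lam (gen y) z, lam (gen y) (lam h z)) \<in> orbit_rel E"
    using invariant_equivD(6)[OF orbit_rel(1)[OF E sub]] X by simp
  moreover have "lam (gen y) (lam h z) = s x z"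
    using lam_mult[of "gen y" h] h X by (metis comp_apply gen_closed lam_gen)
  ultimately show ?thesis using invariant_equivD(4)[OF orbit_rel(1)[OF E sub]] X
    by (simp add: lam_gen)
qed

section \<open>Zero sum ideals of the iterated retractions\<close>

lemma invariant_equiv_ret_eq: "invariant_equiv (ret_eq n)"
proof -
  have "\<forall>x y. (x, y) \<in> ret_eq n \<longrightarrow> (lam g x, lam g y) \<in> ret_eq n" if "g \<in> carrier G" for g
    using that
  proof (induction rule: gen_induct)
    case (gen g x)
    then show ?case using ret_eq_s by (simp add: lam_mult lam_gen)
  next
    case (inv g x)
    then show ?case using ret_eq_cdot by (simp add: lam_mult lam_inv_gen)
  qed simp
  then show ?thesis using equiv_ret_eq by (simp add: invariant_equiv_def)
qed

text \<open>The induction runs over cocycle vectors, adding differences of unit vectors at points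
  related at stage n+1. Exchanging one such point for the other in the last translation replaces
  some \<open>s v\<close> by \<open>s u\<close> with u, v related at stage n+1, which is invisible
  modulo stage n.\<close>

lemma zero_sum_ret_eq_Suc: "zero_sum (ret_eq (Suc n)) \<subseteq> stab (ret_eq n)"
proof
  fix g assume g: "g \<in> zero_sum (ret_eq (Suc n))"
  note E = invariant_equivD[OF invariant_equiv_ret_eq[of n]]
  have "\<forall>g\<in>carrier G. coc g = a \<longrightarrow> g \<in> stab (ret_eq n)"
    if "\<And>y. y \<notin> X \<Longrightarrow> a y = 0" "\<And>x. x \<in> X \<Longrightarrow> (\<Sum>y\<in>ret_eq (Suc n) `` {x}. a y) = 0" for a
  proof (rule zero_class_sums_induct[where P = "\<lambda>a. \<forall>g\<in>carrier G. coc g = a \<longrightarrow> g \<in> stab (ret_eq n)",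
        OF finite equiv_ret_eq[of "Suc n"] that])
    show "\<forall>g\<in>carrier G. coc g = (\<lambda>_. 0) \<longrightarrow> g \<in> stab (ret_eq n)"
    proof (intro ballI impI)
      fix g assume "g \<in> carrier G" "coc g = (\<lambda>_. 0)"
      then have "g = \<one>" using inj_onD[OF coc_inj, of g \<one>] by (simp add: coc_one)
      then show "g \<in> stab (ret_eq n)"
        using subgroup.one_closed[OF subgroup_stab[OF invariant_equiv_ret_eq]] by simp
    qed
  next
    fix a x y assume IH: "\<forall>g\<in>carrier G. coc g = a \<longrightarrow> g \<in> stab (ret_eq n)"
      and a: "\<And>z. z \<notin> X \<Longrightarrow> a z = 0" and xy: "(x, y) \<in> ret_eq (Suc n)"
    have X: "x \<in> X" "y \<in> X" using xy ret_eq_subset[of "Suc n"] by blast+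
    \<comment> \<open>\<open>k\<close> is the common part: \<open>add_gen y k\<close> has vector
      \<open>a\<close>, and \<open>add_gen x k\<close> has the vector of the next step.\<close>
    have "\<exists>k\<in>carrier G. coc k = (\<lambda>z. a z - unit_vec y z)"
      using a X by (intro coc_surj) (auto simp: unit_vec_def)
    then obtain k where k: "k \<in> carrier G" "coc k = (\<lambda>z. a z - unit_vec y z)" by blast
    have ky: "add_gen y k \<in> stab (ret_eq n)"
      using IH k X by (simp add: coc_add_gen add_gen_closed)
    show "\<forall>g\<in>carrier G. coc g = (\<lambda>z. a z + unit_vec x z - unit_vec y z) \<longrightarrow> g \<in> stab (ret_eq n)"
    proof (intro ballI impI)
      fix g assume g: "g \<in> carrier G" "coc g = (\<lambda>z. a z + unit_vec x z - unit_vec y z)"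
      have "g = add_gen x k"
        using inj_onD[OF coc_inj, of g "add_gen x k"] g k X
        by (simp add: coc_add_gen add_gen_closed fun_eq_iff)
      then have lamg: "lam g z = lam k (s (lam (inv k) x) z)"
        and lamy: "lam (add_gen y k) z = lam k (s (lam (inv k) y) z)" for z
        using k X by (simp_all add: add_gen_def lam_mult lam_gen)
      have "(z, lam g z) \<in> ret_eq n" if z: "z \<in> X" for z
      proof (rule E(5))
        show "(z, lam (add_gen y k) z) \<in> ret_eq n" using ky z by (simp add: stab_def)
        have "(lam (inv k) y, lam (inv k) x) \<in> ret_eq (Suc n)"
          using invariant_equivD(4,6)[OF invariant_equiv_ret_eq[of "Suc n"]] xy k by blast
        then have "(s (lam (inv k) y) z, s (lam (inv k) x) z) \<in> ret_eq n" using z by simp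
        then show "(lam (add_gen y k) z, lam g z) \<in> ret_eq n" using E(6)[OF k(1)] by (simp add: lamg lamy)
      qed
      then show "g \<in> stab (ret_eq n)" using g by (simp add: stab_def)
    qed
  qed
  then show "g \<in> stab (ret_eq n)" using g coc_outside by (auto simp: zero_sum_def)
qed

lemma stab_mono: "E \<subseteq> F \<Longrightarrow> stab E \<subseteq> stab F"
  by (auto simp: stab_def)

text \<open>The class sums are homomorphisms on \<open>M\<close> with common kernel
  \<open>zero_sum E\<close>. They are indexed by points, so each class sum occurs once for every
  point of its class.\<close>

lemma poly_Z_zero_sum_extension:
  assumes M: "subgroup M G" and E: "invariant_equiv E" and sub: "M \<subseteq> stab E"
    and Z: "zero_sum E \<subseteq> M" and poly: "poly_Z (G\<lparr>carrier := zero_sum E\<rparr>)"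
  shows "poly_Z (G\<lparr>carrier := M\<rparr>)"
proof (rule poly_Z_integer_family_extension[OF finite M])
  fix x assume "x \<in> X"
  then show "(\<lambda>g. \<Sum>y\<in>E `` {x}. coc g y) \<in> hom (G\<lparr>carrier := M\<rparr>) integer_group"
    using sub subgroup.mem_carrier[OF M] by (intro homI) (auto simp: class_sum_mult[OF E])
next
  have "{g \<in> M. \<forall>x\<in>X. (\<Sum>y\<in>E `` {x}. coc g y) = 0} = zero_sum E"
    using Z subgroup.mem_carrier[OF M] by (auto simp: zero_sum_def)
  then show "poly_Z (G\<lparr>carrier := {g \<in> M. \<forall>x\<in>X. (\<Sum>y\<in>E `` {x}. coc g y) = 0}\<rparr>)"
    using poly by simp
qed

text \<open>Stage 0 is trivial because its classes are singletons and \<open>coc\<close> is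
  injective. At the next stage the sums over the classes of \<open>ret_eq n\<close> are
  homomorphisms, by \<open>zero_sum_ret_eq_Suc\<close>.\<close>

lemma poly_Z_zero_sum_ret_eq: "poly_Z (G\<lparr>carrier := zero_sum (ret_eq n)\<rparr>)"
proof (induction n)
  case 0
  have "zero_sum (ret_eq 0) = {\<one>}"
  proof
    show "zero_sum (ret_eq 0) \<subseteq> {\<one>}"
    proof
      fix g assume g: "g \<in> zero_sum (ret_eq 0)"
      have "coc g y = 0" for y
      proof (cases "y \<in> X")
        case True
        then have "Id_on X `` {y} = {y}" by auto
        then show ?thesis using g True by (force simp: zero_sum_def)
      qed (use g coc_outside in \<open>simp add: zero_sum_def\<close>)
      then have "coc g = coc \<one>" by (auto simp: coc_one)
      then show "g \<in> {\<one>}" using inj_onD[OF coc_inj, of g \<one>] g by (simp add: zero_sum_def)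
    qed
  qed (auto simp: zero_sum_def coc_one)
  then show ?case
    using group.subgroup_self[OF subgroup_imp_group[OF triv_subgroup]]
    by (auto simp: poly_Z_def intro!: exI[of _ 0] exI[of _ "\<lambda>_. {\<one>}"])
next
  case (Suc n)
  have "zero_sum (ret_eq (Suc n)) \<subseteq> stab (ret_eq (Suc n))"
    using zero_sum_ret_eq_Suc stab_mono[OF ret_eq_Suc] by blast
  then have "subgroup (zero_sum (ret_eq (Suc n))) G"
    by (intro subgroup_zero_sum invariant_equiv_ret_eq)
  moreover have "zero_sum (ret_eq n) \<subseteq> zero_sum (ret_eq (Suc n))"
    using equiv_ret_eq equiv_ret_eq ret_eq_Suc by (rule zero_sum_mono)
  ultimately show ?case
    using poly_Z_zero_sum_extension[OF _ invariant_equiv_ret_eq zero_sum_ret_eq_Suc _ Suc] by blast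
qed

text \<open>With at most one class every element lies in \<open>stab\<close>, so one last extension
  reaches the whole group.\<close>

lemma poly_Z_if_ret_eq_full:
  assumes "ret_eq n = X \<times> X"
  shows "poly_Z G"
proof -
  have "poly_Z (G\<lparr>carrier := carrier G\<rparr>)"
  proof (rule poly_Z_zero_sum_extension[OF subgroup_self invariant_equiv_ret_eq[of n] _ _ poly_Z_zero_sum_ret_eq])
    show "carrier G \<subseteq> stab (ret_eq n)" by (auto simp: stab_def assms)
  qed (auto simp: zero_sum_def)
  then show ?thesis by simp
qed

section \<open>Left ordered structure groups\<close>

definition socle :: "'g set" where
  "socle = {g \<in> carrier G. lam g = id}"

lemma lam_inv_socle: "g \<in> socle \<Longrightarrow> lam (inv g) = id"
  by (rule ext) (metis (mono_tags, lifting) lam_inv(1) socle_def id_apply mem_Collect_eq)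

lemma subgroup_socle: "subgroup socle G"
proof (rule subgroupI)
  show "inv g \<in> socle" if "g \<in> socle" for g
    using that lam_inv_socle[OF that] by (simp add: socle_def)
qed (auto simp: socle_def lam_mult intro!: exI[of _ \<one>])

lemma coc_socle_mult:
  assumes "g \<in> socle" "h \<in> carrier G"
  shows "coc (g \<otimes> h) = (\<lambda>y. coc g y + coc h y)"
  using assms lam_inv_socle[OF assms(1)] by (auto simp: socle_def coc_mult')

text \<open>\<open>coc\<close> is injective, and additive on the socle.\<close>

lemma socle_commute:
  assumes "g \<in> socle" "h \<in> socle"
  shows "g \<otimes> h = h \<otimes> g"
proof (rule inj_onD[OF coc_inj])
  show "coc (g \<otimes> h) = coc (h \<otimes> g)"
    using assms by (simp add: coc_socle_mult add.commute socle_def)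
qed (use assms in \<open>auto simp: socle_def\<close>)

lemma socle_conj:
  assumes g: "g \<in> socle" and k: "k \<in> carrier G"
  shows "k \<otimes> g \<otimes> inv k \<in> socle" "coc (k \<otimes> g \<otimes> inv k) = (\<lambda>y. coc g (lam (inv k) y))"
proof -
  have gc: "g \<in> carrier G" using g by (simp add: socle_def)
  show s: "k \<otimes> g \<otimes> inv k \<in> socle"
    using g k lam_mult[of k "inv k"] by (simp add: socle_def lam_mult)
  have "coc (k \<otimes> g \<otimes> inv k \<otimes> k) = (\<lambda>y. coc (k \<otimes> g \<otimes> inv k) y + coc k y)"
    using s k by (rule coc_socle_mult)
  moreover have "k \<otimes> g \<otimes> inv k \<otimes> k = k \<otimes> g" using gc k by (simp add: m_assoc)
  ultimately have "coc (k \<otimes> g \<otimes> inv k) y + coc k y = coc g (lam (inv k) y) + coc k y" for y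
    using coc_mult'[OF k gc, of y] by (simp add: fun_eq_iff)
  then show "coc (k \<otimes> g \<otimes> inv k) = (\<lambda>y. coc g (lam (inv k) y))" by auto
qed

lemma socle_pow:
  assumes "g \<in> socle"
  shows "g [^] (n::nat) \<in> socle" "coc (g [^] n) = (\<lambda>y. int n * coc g y)"
proof -
  have "g [^] n \<in> socle \<and> coc (g [^] n) = (\<lambda>y. int n * coc g y)"
  proof (induction n)
    case 0
    show ?case using subgroup.one_closed[OF subgroup_socle] by (simp add: coc_one)
  next
    case (Suc n)
    moreover have "g \<in> carrier G" using assms by (simp add: socle_def)
    ultimately show ?case
      using assms subgroup.m_closed[OF subgroup_socle, of "g [^] n" g]
        coc_socle_mult[of "g [^] n" g] by (simp add: algebra_simps)
  qed
  then show "g [^] n \<in> socle" "coc (g [^] n) = (\<lambda>y. int n * coc g y)" by auto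
qed

lemma coc_inv_socle:
  assumes "g \<in> socle"
  shows "coc (inv g) = (\<lambda>y. - coc g y)"
proof
  fix y
  have "coc (g \<otimes> inv g) y = coc g y + coc (inv g) y"
    using coc_socle_mult[OF assms, of "inv g"] assms by (simp only: socle_def) simp
  then show "coc (inv g) y = - coc g y" using assms by (simp add: coc_one socle_def)
qed

section \<open>Socle elements obtained from finiteness of the permutation action\<close>

lemma lam_pigeonhole:
  assumes "\<And>i::nat. f i \<in> carrier G"
  shows "\<exists>i j. i < j \<and> lam (f i) = lam (f j)"
proof -
  have "range (\<lambda>i. lam (f i)) \<subseteq> {p. p permutes X}" using assms lam_permutes by auto
  then have "finite (range (\<lambda>i. lam (f i)))"
    using finite_subset finite_permutations[OF finite] by blast
  then have "\<not> inj (\<lambda>i. lam (f i))" using finite_imageD infinite_UNIV_nat by blast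
  then obtain i j where "i \<noteq> j" "lam (f i) = lam (f j)" by (auto simp: inj_def)
  then show ?thesis by (metis nat_neq_iff)
qed

lemma ex_pow_in_socle:
  assumes h: "h \<in> carrier G"
  shows "\<exists>m::nat. h [^] Suc m \<in> socle"
proof -
  obtain i j :: nat where ij: "i < j" "lam (h [^] i) = lam (h [^] j)"
    using lam_pigeonhole[of "\<lambda>i. h [^] i"] h by auto
  then obtain m where m: "j = i + Suc m" using less_imp_Suc_add by fastforce
  have "lam (h [^] i) (lam (h [^] Suc m) y) = lam (h [^] i) y" for y
  proof -
    have "h [^] j = h [^] i \<otimes> h [^] Suc m" using h by (simp only: m nat_pow_mult)
    then have "lam (h [^] j) = lam (h [^] i) \<circ> lam (h [^] Suc m)" using h by (simp only: lam_mult nat_pow_closed)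
    then show ?thesis using ij(2) by (metis comp_apply)
  qed
  then have "lam (h [^] Suc m) y = y" for y
    using permutes_inj[OF lam_permutes[of "h [^] i"]] h by (metis injD nat_pow_closed)
  then show ?thesis using h by (auto simp: socle_def intro!: exI[of _ m])
qed

text \<open>Among the elements whose cocycles are the multiples of one unit vector, two act alike;
  their quotient acts trivially and its cocycle is the difference of theirs.\<close>

lemma ex_unit_multiple_in_socle:
  assumes x: "x \<in> X"
  shows "\<exists>m>0. \<exists>g\<in>socle. coc g = (\<lambda>y. int m * unit_vec x y)"
proof -
  have "\<exists>g\<in>carrier G. coc g = (\<lambda>y. int i * unit_vec x y)" for i
    using x by (intro coc_surj) (auto simp: unit_vec_def)
  then obtain f where f: "\<And>i. f i \<in> carrier G" "\<And>i. coc (f i) = (\<lambda>y. int i * unit_vec x y)"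
    by metis
  obtain i j where ij: "i < j" "lam (f i) = lam (f j)" using lam_pigeonhole[of f] f by blast
  have *: "lam (f j) (lam (inv (f i)) y) = y" "lam (inv (f j)) y = lam (inv (f i)) y" for y
  proof -
    show 1: "lam (f j) (lam (inv (f i)) y) = y" for y
      using ij(2) f by (metis lam_inv(2))
    show "lam (inv (f j)) y = lam (inv (f i)) y"
      using 1[of y] f by (metis lam_inv(1))
  qed
  define g where "g = f j \<otimes> inv (f i)"
  have "g \<in> socle" using f * by (auto simp: g_def socle_def lam_mult)
  moreover have "coc g y = int (j - i) * unit_vec x y" for y
  proof -
    have "coc (f i) y + coc (inv (f i)) (lam (inv (f i)) y) = 0"
      using coc_mult'[of "f i" "inv (f i)" y] f(1) by (simp add: coc_one)
    moreover have "coc g y = coc (f j) y + coc (inv (f i)) (lam (inv (f i)) y)"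
      using coc_mult'[of "f j" "inv (f i)" y] f(1) * by (simp add: g_def)
    ultimately have "coc g y = coc (f j) y - coc (f i) y" by simp
    then show ?thesis using f(2) ij(1) by (simp add: algebra_simps of_nat_diff)
  qed
  ultimately show ?thesis using ij(1) by (intro exI[of _ "j - i"]) auto
qed

lemma ex_difference_multiple_in_socle:
  "\<exists>d>0. \<forall>x\<in>X. \<forall>y\<in>X. \<exists>g\<in>socle. coc g = (\<lambda>z. int d * (unit_vec x z - unit_vec y z))"
proof -
  obtain m where m: "\<And>x. x \<in> X \<Longrightarrow> 0 < m x"
    "\<And>x. x \<in> X \<Longrightarrow> \<exists>g\<in>socle. coc g = (\<lambda>y. int (m x) * unit_vec x y)"
    using ex_unit_multiple_in_socle by metis
  \<comment> \<open>A common multiple of all \<open>m x\<close>, so that one \<open>d\<close> serves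
    every pair.\<close>
  define d where "d = prod m X"
  have d: "\<exists>g\<in>socle. coc g = (\<lambda>y. int d * unit_vec x y)" if x: "x \<in> X" for x
  proof -
    obtain g where g: "g \<in> socle" "coc g = (\<lambda>y. int (m x) * unit_vec x y)" using m(2) x by blast
    have "m x dvd d" unfolding d_def using finite x by (rule dvd_prodI)
    then obtain k where "d = m x * k" ..
    then show ?thesis using socle_pow[OF g(1), of k] g(2)
      by (intro bexI[of _ "g [^] k"]) (auto simp: algebra_simps)
  qed
  have "\<exists>g\<in>socle. coc g = (\<lambda>z. int d * (unit_vec x z - unit_vec y z))" if xy: "x \<in> X" "y \<in> X" for x y
  proof -
    obtain g h where gh: "g \<in> socle" "coc g = (\<lambda>z. int d * unit_vec x z)"
      "h \<in> socle" "coc h = (\<lambda>z. int d * unit_vec y z)" using d xy by blast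
    then have "inv h \<in> socle" "inv h \<in> carrier G"
      using subgroup.m_inv_closed[OF subgroup_socle] by (auto simp: socle_def)
    then show ?thesis
      using gh subgroup.m_closed[OF subgroup_socle, of g "inv h"]
      by (intro bexI[of _ "g \<otimes> inv h"]) (auto simp: coc_socle_mult coc_inv_socle algebra_simps)
  qed
  moreover have "d > 0" using m(1) by (simp add: d_def prod_pos)
  ultimately show ?thesis by blast
qed

lemma finite_lam_image: "H \<subseteq> carrier G \<Longrightarrow> finite (lam ` H)"
  using finite_subset[OF _ finite_permutations[OF finite]] lam_permutes by blast

text \<open>
  Averaging over the finite group \<open>lam ` H\<close> yields a vector that is constant on the orbits of
  \<open>H\<close> and has vanishing class sums.
\<close>

lemma conj_product_eq_one:
  assumes E: "invariant_equiv E" "zero_sum E \<subseteq> stab E" and fixed: "orbit_rel E = E"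
    and a: "a \<in> socle" "a \<in> zero_sum E"
  shows "\<exists>gs. gs \<noteq> [] \<and> set gs \<subseteq> zero_sum E \<and> foldr (\<lambda>g p. g \<otimes> a \<otimes> inv g \<otimes> p) gs \<one> = \<one>"
proof -
  let ?H = "zero_sum E" and ?P = "lam ` zero_sum E"
  interpret H: subgroup ?H G using E by (rule subgroup_zero_sum)
  have fin: "finite ?P" using H.subset by (rule finite_lam_image)
  from finite_distinct_list[OF fin] obtain ps where ps: "set ps = ?P" "distinct ps" by auto
  \<comment> \<open>By \<open>socle_conj\<close>, conjugation by \<open>g\<close> composes the
    cocycle of \<open>a\<close> with \<open>lam (inv g)\<close>; hence representatives are chosen by
    the permutation of their inverse.\<close>
  have "\<exists>g\<in>?H. lam (inv g) = p" if p: "p \<in> ?P" for p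
  proof -
    obtain h where "h \<in> ?H" "p = lam h" using p by blast
    then show ?thesis by (intro bexI[of _ "inv h"]) simp_all
  qed
  then obtain rep where rep: "\<And>p. p \<in> ?P \<Longrightarrow> rep p \<in> ?H" "\<And>p. p \<in> ?P \<Longrightarrow> lam (inv (rep p)) = p"
    by metis
  let ?prod = "\<lambda>ps. foldr (\<lambda>g p. g \<otimes> a \<otimes> inv g \<otimes> p) (map rep ps) \<one>"
  have prod: "?prod qs \<in> carrier G \<and> coc (?prod qs) = (\<lambda>y. \<Sum>p\<leftarrow>qs. coc a (p y))"
    if "set qs \<subseteq> ?P" for qs
    using that
  proof (induction qs)
    case (Cons q qs)
    then have q: "rep q \<in> carrier G" "lam (inv (rep q)) = q" using rep by auto
    note c = socle_conj[OF a(1) q(1)]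
    have "?prod qs \<in> carrier G" "coc (?prod qs) = (\<lambda>y. \<Sum>p\<leftarrow>qs. coc a (p y))"
      using Cons by auto
    then show ?case using c coc_socle_mult[OF c(1)] q subgroup.mem_carrier[OF subgroup_socle c(1)]
      by simp
  qed (simp add: coc_one)
  define w where "w y = (\<Sum>p\<in>?P. coc a (p y))" for y
  have coc_w: "coc (?prod ps) = w"
    using prod[of ps] ps by (simp add: w_def sum_list_distinct_conv_sum_set fun_eq_iff)
  \<comment> \<open>Right translation by \<open>lam g\<close> permutes the finite group
    \<open>?P\<close>.\<close>
  have const: "w (lam g y) = w y" if g: "g \<in> ?H" for g y
    unfolding w_def
  proof (rule sum.reindex_bij_witness[where i = "\<lambda>p. p \<circ> lam (inv g)" and j = "\<lambda>p. p \<circ> lam g"])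
    have *: "p \<circ> lam k \<in> ?P" if p: "p \<in> ?P" "k \<in> ?H" for p k
    proof -
      obtain h where "h \<in> ?H" "p = lam h" using p by blast
      then show ?thesis using p by (intro image_eqI[of _ _ "h \<otimes> k"]) (auto simp: lam_mult)
    qed
    show "p \<circ> lam g \<in> ?P" "p \<circ> lam (inv g) \<in> ?P" if "p \<in> ?P" for p
      using * that g by blast+
  qed (use g in \<open>auto simp: fun_eq_iff\<close>)
  have "w x = 0" if x: "x \<in> X" for x
  proof -
    let ?C = "E `` {x}"
    have sum0: "(\<Sum>y\<in>?C. coc a (p y)) = 0" if p: "p \<in> ?P" for p
    proof -
      obtain g where g: "g \<in> ?H" "p = lam (inv g)" using rep p by metis
      have "E `` {lam g x} = ?C" using g(1) E(2) by (intro class_stab[OF E(1) _ x]) blast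
      then have "(\<Sum>y\<in>?C. coc a (p y)) = (\<Sum>y\<in>?C. coc a y)"
        using class_sum_lam[OF E(1) H.mem_carrier[OF g(1)] x, of "coc a"] by (simp only: g(2))
      also have "\<dots> = 0" using a(2) x unfolding zero_sum_def by blast
      finally show ?thesis .
    qed
    have "(\<Sum>y\<in>?C. w y) = 0"
      unfolding w_def by (subst sum.swap) (intro sum.neutral ballI sum0)
    \<comment> \<open>By \<open>fixed\<close> the class is a single orbit, so \<open>w\<close> is
      constant on it and the zero sum forces \<open>w\<close> to vanish there.\<close>
    moreover have "w y = w x" if "y \<in> ?C" for y
    proof -
      have "(x, y) \<in> orbit_rel E" using that fixed by simp
      then show ?thesis using const by (auto simp: orbit_rel_def)
    qed
    ultimately have "of_nat (card ?C) * w x = 0" by simp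
    moreover have "card ?C \<noteq> 0" using invariant_equivD(3,7)[OF E(1)] x by auto
    ultimately show ?thesis by simp
  qed
  moreover have "w x = 0" if "x \<notin> X" for x
  proof -
    have "coc a (p x) = 0" if "p \<in> ?P" for p
    proof -
      obtain h where "h \<in> ?H" "p = lam h" using \<open>p \<in> ?P\<close> by blast
      then show ?thesis using \<open>x \<notin> X\<close> a(2) H.mem_carrier by (intro coc_outside) auto
    qed
    then show ?thesis by (simp add: w_def)
  qed
  ultimately have "coc (?prod ps) = coc \<one>" by (auto simp: coc_w coc_one)
  then have "?prod ps = \<one>" using inj_onD[OF coc_inj, of "?prod ps" \<one>] prod[of ps] ps by simp
  moreover have "ps \<noteq> []" using ps(1) imageI[OF H.one_closed, of lam] by force
  moreover have "set (map rep ps) \<subseteq> ?H" using rep(1) ps(1) by auto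
  ultimately show ?thesis by (intro exI[of _ "map rep ps"]) simp
qed

text \<open>\<open>a\<close> is the largest of the finitely many elements whose cocycle is
  \<open>d\<close> times a difference of unit vectors at equivalent points. Products of such
  elements are bounded by powers of \<open>a\<close>, and every element of \<open>zero_sum E\<close>
  has a positive power that is such a product.\<close>

lemma ex_cofinal_in_socle:
  assumes L: "left_ordered_group G L"
    and E: "invariant_equiv E" "zero_sum E \<subseteq> stab E" and ne: "\<not> E \<subseteq> Id"
  shows "\<exists>a \<in> socle \<inter> zero_sum E. left_ordered_group.cofinal G L (zero_sum E) a"
proof -
  interpret O: left_ordered_group G L by (rule L)
  note ED = invariant_equivD[OF E(1)]
  obtain d where d: "d > 0"
    "\<And>x y. x \<in> X \<Longrightarrow> y \<in> X \<Longrightarrow> \<exists>g\<in>socle. coc g = (\<lambda>z. int d * (unit_vec x z - unit_vec y z))"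
    using ex_difference_multiple_in_socle by metis
  define B where "B = {g \<in> carrier G. \<exists>x y. (x, y) \<in> E \<and> coc g = (\<lambda>z. int d * (unit_vec x z - unit_vec y z))}"
  have ex: "\<exists>g\<in>B. coc g = (\<lambda>z. int d * (unit_vec x z - unit_vec y z))" if xy: "(x, y) \<in> E" for x y
  proof -
    have "x \<in> X" "y \<in> X" using xy ED(2) by auto
    then obtain g where g: "g \<in> socle" "coc g = (\<lambda>z. int d * (unit_vec x z - unit_vec y z))"
      using d(2) by blast
    then have "g \<in> B" using xy by (auto simp: B_def socle_def)
    then show ?thesis using g(2) by blast
  qed
  have BS: "B \<subseteq> socle"
  proof
    fix g assume "g \<in> B"
    then obtain x y where g: "g \<in> carrier G" "(x, y) \<in> E" "coc g = (\<lambda>z. int d * (unit_vec x z - unit_vec y z))"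
      by (auto simp: B_def)
    then have "x \<in> X" "y \<in> X" using ED(2) by auto
    then obtain h where h: "h \<in> socle" "coc h = coc g" using d(2) g(3) by metis
    then have "g = h" using inj_onD[OF coc_inj, of g h] g(1) by (simp add: socle_def)
    then show "g \<in> socle" using h by simp
  qed
  have BZ: "B \<subseteq> zero_sum E"
  proof
    fix g assume "g \<in> B"
    then obtain x y where g: "g \<in> carrier G" "(x, y) \<in> E" "coc g = (\<lambda>z. int d * (unit_vec x z - unit_vec y z))"
      by (auto simp: B_def)
    have "(\<Sum>z\<in>E `` {v}. coc g z) = 0" for v
    proof -
      have "x \<in> E `` {v} \<longleftrightarrow> y \<in> E `` {v}" using g(2) ED(4,5) by blast
      then show ?thesis using ED(7)
        by (simp add: g(3) sum_distrib_left[symmetric] sum_subtractf sum_unit_vec)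
    qed
    then show "g \<in> zero_sum E" using g(1) by (simp add: zero_sum_def)
  qed
  interpret H: subgroup "zero_sum E" G using E by (rule subgroup_zero_sum)
  have finB: "finite B"
  proof (rule finite_imageD)
    have "coc ` B \<subseteq> (\<lambda>(x, y) z. int d * (unit_vec x z - unit_vec y z)) ` (X \<times> X)"
      using ED(2) by (fastforce simp: B_def)
    then show "finite (coc ` B)" using finite by (meson finite_SigmaI finite_imageI finite_subset)
    show "inj_on coc B" using coc_inj by (rule inj_on_subset) (auto simp: B_def)
  qed
  obtain x y where xy: "(x, y) \<in> E" "x \<noteq> y" using ne by auto
  obtain b where b: "b \<in> B" "coc b = (\<lambda>z. int d * (unit_vec x z - unit_vec y z))" using ex[OF xy(1)] by blast
  obtain c where c: "c \<in> B" "coc c = (\<lambda>z. int d * (unit_vec y z - unit_vec x z))"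
    using ex[OF ED(4)[OF xy(1)]] by blast
  have bc: "b \<in> carrier G" "c \<in> carrier G" using b c by (auto simp: B_def)
  have "coc b x \<noteq> 0" "coc c x \<noteq> 0" using xy(2) d(1) b(2) c(2) by (auto simp: unit_vec_def)
  then have ne1: "b \<noteq> \<one>" "c \<noteq> \<one>" by (auto simp: coc_one)
  have "coc (b \<otimes> c) = coc \<one>"
    using coc_socle_mult[of b c] b c BS bc by (auto simp: coc_one algebra_simps)
  then have bc1: "b \<otimes> c = \<one>" using inj_onD[OF coc_inj, of "b \<otimes> c" \<one>] bc by simp
  obtain a where a: "a \<in> B" "\<And>g. g \<in> B \<Longrightarrow> g = a \<or> (g, a) \<in> L"
    using O.finite_has_max[OF finB] b(1) by (auto simp: B_def)
  have ac: "a \<in> carrier G" using a(1) by (simp add: B_def)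
  \<comment> \<open>\<open>b\<close> and \<open>c\<close> are nontrivial and inverse to each other,
    so one of them is positive, and with it the maximum \<open>a\<close>.\<close>
  have "(\<one>, b) \<in> L \<or> (\<one>, c) \<in> L"
  proof (rule ccontr)
    assume "\<not> ?thesis"
    then have "(b, \<one>) \<in> L" "(c, \<one>) \<in> L" using O.less_linear[of _ \<one>] bc ne1 by blast+
    then have "(b \<otimes> c, \<one>) \<in> L" using O.mult_neg[OF bc] O.less_trans by blast
    then show False using bc1 O.less_irrefl by simp
  qed
  then have a1: "(\<one>, a) \<in> L" using a(2)[OF b(1)] a(2)[OF c(1)] O.less_trans by blast
  have aS: "a \<in> socle" using a(1) BS by blast
  \<comment> \<open>Inductively g = e h with \<open>e\<close> in \<open>B\<close> and h at most a^n.
    Then g is at most e a^n = a^n e, which is at most a^n a; the equality holds because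
    \<open>e\<close> and \<open>a\<close> lie in the abelian socle.\<close>
  have bound: "\<forall>g\<in>carrier G. coc g = (\<lambda>z. int d * v z) \<longrightarrow> (\<exists>n::nat. g = a [^] n \<or> (g, a [^] n) \<in> L)"
    if "\<And>y. y \<notin> X \<Longrightarrow> v y = 0" "\<And>x. x \<in> X \<Longrightarrow> (\<Sum>y\<in>E `` {x}. v y) = 0" for v
  proof (rule zero_class_sums_induct[where P = "\<lambda>v. \<forall>g\<in>carrier G. coc g = (\<lambda>z. int d * v z) \<longrightarrow>
      (\<exists>n::nat. g = a [^] n \<or> (g, a [^] n) \<in> L)", OF finite ED(1) that])
    show "\<forall>g\<in>carrier G. coc g = (\<lambda>z. int d * 0) \<longrightarrow> (\<exists>n::nat. g = a [^] n \<or> (g, a [^] n) \<in> L)"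
    proof (intro ballI impI)
      fix g assume "g \<in> carrier G" "coc g = (\<lambda>z. int d * 0)"
      then have "g = \<one>" using inj_onD[OF coc_inj, of g \<one>] by (simp add: coc_one)
      then show "\<exists>n::nat. g = a [^] n \<or> (g, a [^] n) \<in> L" by (intro exI[of _ 0]) simp
    qed
  next
    fix v x y
    assume IH: "\<forall>g\<in>carrier G. coc g = (\<lambda>z. int d * v z) \<longrightarrow> (\<exists>n::nat. g = a [^] n \<or> (g, a [^] n) \<in> L)"
      and v: "\<And>z. z \<notin> X \<Longrightarrow> v z = 0" and xy: "(x, y) \<in> E"
    show "\<forall>g\<in>carrier G. coc g = (\<lambda>z. int d * (v z + unit_vec x z - unit_vec y z)) \<longrightarrow>
        (\<exists>n::nat. g = a [^] n \<or> (g, a [^] n) \<in> L)"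
    proof (intro ballI impI)
      fix g assume g: "g \<in> carrier G" "coc g = (\<lambda>z. int d * (v z + unit_vec x z - unit_vec y z))"
      have "\<exists>h\<in>carrier G. coc h = (\<lambda>z. int d * v z)" using v by (intro coc_surj) simp
      then obtain h where h: "h \<in> carrier G" "coc h = (\<lambda>z. int d * v z)" by blast
      then obtain n :: nat where n: "h = a [^] n \<or> (h, a [^] n) \<in> L" using IH by blast
      obtain e where e: "e \<in> B" "coc e = (\<lambda>z. int d * (unit_vec x z - unit_vec y z))"
        using ex[OF xy] by blast
      have eS: "e \<in> socle" and ec: "e \<in> carrier G" using e(1) BS by (auto simp: B_def)
      have "coc g = coc (e \<otimes> h)"
        using coc_socle_mult[OF eS h(1)] by (simp add: g(2) e(2) h(2) algebra_simps)
      then have "g = e \<otimes> h" using inj_onD[OF coc_inj] g(1) h(1) ec by simp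
      then have "g = e \<otimes> a [^] n \<or> (g, e \<otimes> a [^] n) \<in> L"
        using n O.left_mono[OF h(1) _ ec] ac by auto
      moreover have "e \<otimes> a [^] n = a [^] n \<otimes> e"
        using socle_commute[OF eS socle_pow(1)[OF aS]] .
      moreover have "a [^] n \<otimes> e = a [^] n \<otimes> a \<or> (a [^] n \<otimes> e, a [^] n \<otimes> a) \<in> L"
        using a(2)[OF e(1)] O.left_mono[OF ec ac] ac by auto
      ultimately have "g = a [^] Suc n \<or> (g, a [^] Suc n) \<in> L"
        using O.less_trans by auto
      then show "\<exists>n::nat. g = a [^] n \<or> (g, a [^] n) \<in> L" ..
    qed
  qed
  have "\<exists>n::nat. (h, a [^] n) \<in> L" if h: "h \<in> zero_sum E" for h
  proof -
    have hc: "h \<in> carrier G" using h by (rule H.mem_carrier)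
    obtain m :: nat where m: "h [^] Suc m \<in> socle" using ex_pow_in_socle[OF hc] ..
    have hm: "h [^] k \<in> zero_sum E" for k :: nat using h by (induction k) auto
    \<comment> \<open>The exponent \<open>Suc m\<close> reaches the socle, and the exponent
      \<open>d\<close> gives the cocycle the factor \<open>d\<close> that \<open>bound\<close>
      requires.\<close>
    let ?g = "(h [^] Suc m) [^] d"
    have gc: "?g \<in> carrier G" using hc by simp
    have cg: "coc ?g = (\<lambda>z. int d * coc (h [^] Suc m) z)" using m by (rule socle_pow)
    have "\<exists>n::nat. ?g = a [^] n \<or> (?g, a [^] n) \<in> L"
    proof -
      have "coc (h [^] Suc m) y = 0" if "y \<notin> X" for y using that hc by (intro coc_outside) auto
      moreover have "(\<Sum>y\<in>E `` {x}. coc (h [^] Suc m) y) = 0" if "x \<in> X" for x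
        using hm[of "Suc m"] that unfolding zero_sum_def by blast
      ultimately show ?thesis using bound[of "coc (h [^] Suc m)"] gc cg by blast
    qed
    then obtain n :: nat where n: "?g = a [^] n \<or> (?g, a [^] n) \<in> L" ..
    \<comment> \<open>Turns the weak bound into the strict one demanded by
      \<open>cofinal\<close>.\<close>
    have step: "(a [^] n, a [^] Suc n) \<in> L" using O.mult_pos[of "a [^] n" a] ac a1 by simp
    have gn: "(?g, a [^] Suc n) \<in> L" using n step O.less_trans by auto
    consider "h = \<one>" | "(h, \<one>) \<in> L" | "(\<one>, h) \<in> L" using O.less_linear[OF hc one_closed] by blast
    then show ?thesis
    proof cases
      case 1
      then show ?thesis using a1 ac by (intro exI[of _ 1]) simp
    next
      case 2
      then show ?thesis using a1 ac O.less_trans by (intro exI[of _ 1]) auto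
    next
      case 3
      \<comment> \<open>A positive element is at most each of its positive powers; the total
        exponent is written as a successor to fit \<open>le_pow\<close>.\<close>
      obtain k where k: "Suc m * d = Suc k" using d(1) by (metis Suc_pred mult_pos_pos zero_less_Suc)
      have "?g = h [^] Suc k" using hc by (simp only: nat_pow_pow k)
      then have "(h, a [^] Suc n) \<in> L" using gn O.le_pow[OF hc 3, of k] O.less_trans by metis
      then show ?thesis ..
    qed
  qed
  then have "O.cofinal (zero_sum E) a" using ac by (simp add: O.cofinal_def)
  then show ?thesis using a(1) BS BZ by blast
qed

section \<open>Left orderability forces the retractions to collapse\<close>

text \<open>Cofinality makes every nonempty product of conjugates of \<open>a\<close> by elements of
  \<open>zero_sum E\<close> nontrivial, while averaging exhibits a trivial one.\<close>

lemma orbit_rel_fixed_imp_Id: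
  assumes L: "left_ordered_group G L"
    and E: "invariant_equiv E" "zero_sum E \<subseteq> stab E" and fixed: "orbit_rel E = E"
  shows "E \<subseteq> Id"
proof (rule ccontr)
  interpret O: left_ordered_group G L by (rule L)
  assume "\<not> E \<subseteq> Id"
  then obtain a where a: "a \<in> socle" "a \<in> zero_sum E" "O.cofinal (zero_sum E) a"
    using ex_cofinal_in_socle[OF L E] by blast
  obtain gs where gs: "gs \<noteq> []" "set gs \<subseteq> zero_sum E"
    "foldr (\<lambda>g p. g \<otimes> a \<otimes> inv g \<otimes> p) gs \<one> = \<one>"
    using conj_product_eq_one[OF E fixed a(1,2)] by blast
  have H: "subgroup (zero_sum E) G" using E by (rule subgroup_zero_sum)
  have "foldr (\<lambda>g p. g \<otimes> a \<otimes> inv g \<otimes> p) gs \<one> \<noteq> \<one>"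
    using socle_conj(1)[OF a(1)] subgroup.mem_carrier[OF H] socle_commute
    by (intro O.conj_product_ne_one[OF H a(3,1,2) subgroup_socle _ _ gs(2,1)]) auto
  then show False using gs(3) by contradiction
qed

text \<open>Induction on the number of related pairs. A stable \<open>E\<close> lies in the
  equality, which is stage 0. Otherwise the smaller \<open>orbit_rel E\<close> lies in some stage,
  and \<open>s_orbit_rel\<close> puts \<open>E\<close> into the next one.\<close>

lemma invariant_equiv_subset_ret_eq:
  assumes L: "left_ordered_group G L"
    and "invariant_equiv E" "zero_sum E \<subseteq> stab E"
  shows "\<exists>n. E \<subseteq> ret_eq n"
  using assms(2,3)
proof (induction "card E" arbitrary: E rule: less_induct)
  case less
  note E = less.prems
  have EX: "E \<subseteq> X \<times> X" using invariant_equivD(2)[OF E(1)] .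
  then have fin: "finite E" using finite by (meson finite_SigmaI finite_subset)
  note O = orbit_rel[OF E]
  show ?case
  proof (cases "orbit_rel E = E")
    case True
    then have "E \<subseteq> Id" using orbit_rel_fixed_imp_Id[OF L E] by blast
    then have "E \<subseteq> ret_eq 0" using EX by auto
    then show ?thesis ..
  next
    case False
    then have "card (orbit_rel E) < card E" using O(2) fin by (intro psubset_card_mono) auto
    then obtain n where n: "orbit_rel E \<subseteq> ret_eq n" using less.hyps O(1,3) by blast
    have "E \<subseteq> ret_eq (Suc n)"
    proof (rule subrelI)
      fix x y assume xy: "(x, y) \<in> E"
      then have "x \<in> X" "y \<in> X" using EX by auto
      moreover have "(s x z, s y z) \<in> ret_eq n" if "z \<in> X" for z
        using s_orbit_rel[OF E xy that] n by blast
      ultimately show "(x, y) \<in> ret_eq (Suc n)" by simp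
    qed
    then show ?thesis ..
  qed
qed

lemma ret_eq_full_if_left_orderable:
  assumes "left_orderable G"
  shows "\<exists>n. ret_eq n = X \<times> X"
proof -
  obtain L where "strict_linear_order_on (carrier G) L"
    "\<forall>x \<in> carrier G. \<forall>y \<in> carrier G. \<forall>z \<in> carrier G. (x, y) \<in> L \<longrightarrow> (z \<otimes> x, z \<otimes> y) \<in> L"
    using assms by (auto simp: left_orderable_def)
  then have L: "left_ordered_group G L"
    by (intro left_ordered_group.intro left_ordered_group_axioms.intro) (auto intro: is_group)
  \<comment> \<open>The descent starts at the full relation, where the inclusion in
    \<open>stab\<close> is immediate.\<close>
  have "invariant_equiv (X \<times> X)"
    by (auto simp: invariant_equiv_def equiv_def refl_on_def sym_def trans_def)
  moreover have "zero_sum (X \<times> X) \<subseteq> stab (X \<times> X)" by (auto simp: zero_sum_def stab_def)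
  ultimately obtain n where "X \<times> X \<subseteq> ret_eq n" using invariant_equiv_subset_ret_eq[OF L] by blast
  then show ?thesis using ret_eq_subset by blast
qed

end

theorem theorem2p1:
  fixes X :: "'a set" and r :: "'a \<times> 'a \<Rightarrow> 'a \<times> 'a"
  assumes "finite X" and "X \<noteq> {}"
    and "ybe_solution (X, r)" and "non_degenerate (X, r)" and "involutive (X, r)"
  shows "(multipermutation (X, r) \<longleftrightarrow> left_orderable (structure_group (X, r))) \<and>
         (left_orderable (structure_group (X, r)) \<longleftrightarrow> poly_Z (structure_group (X, r)))"
proof -
  interpret finite_solution X r using assms by unfold_locales
  obtain gen lam coc where "structure_brace X r (structure_group (X, r)) gen lam coc"
    using structure_brace_structure_group by blast
  then interpret structure_brace X r "structure_group (X, r)" gen lam coc .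
  \<comment> \<open>The implications form a cycle: multipermutation gives
    poly-\<open>\<int>\<close>, which gives left orderable, which gives multipermutation.\<close>
  show ?thesis
    using multipermutation_iff[OF assms(2)] ret_eq_full_if_left_orderable poly_Z_if_ret_eq_full
      poly_Z_imp_left_orderable by blast
qed

end
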